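(* For any $\varepsilon\in(0,1)$ (which may depend on $n$) and any constant $\delta>0$, there is a randomized algorithm in the LOCAL model which, on any $n$-node graph $G=(V,E)$, runs in $O\!\left(\frac{\log n}{\log^2\log n}\right)$ rounds (the hidden constant may depend on $\delta$) and outputs a matching $M\subseteq E$ such that, with probability at least $1-\frac{1}{\varepsilon}e^{-\Omega(\log^{1-\delta} n)}$, $|M|\ge \frac{|OPT|}{2+\varepsilon}$, where $OPT$ is a maximum cardinality matching of $G$. *)

theory Defs
  imports "HOL-Probability.Probability"
begin

text \<open>Finite simple graphs: vertices are natural numbers (serving as unique IDs),
  edges are 2-element subsets of the vertex set.\<close>
definition simple_graph :: "nat set \<Rightarrow> nat set set \<Rightarrow> bool" where
  "simple_graph V E \<longleftrightarrow> finite V \<and> (\<forall>e\<in>E. e \<subseteq> V \<and> card e = 2)"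

definition is_matching :: "nat set set \<Rightarrow> nat set set \<Rightarrow> bool" where
  "is_matching E M \<longleftrightarrow> M \<subseteq> E \<and> (\<forall>e\<in>M. \<forall>e'\<in>M. e \<noteq> e' \<longrightarrow> e \<inter> e' = {})"

definition max_matching_size :: "nat set set \<Rightarrow> nat" where
  "max_matching_size E = Max (card ` {M. is_matching E M})"

fun hop_within :: "nat set set \<Rightarrow> nat \<Rightarrow> nat \<Rightarrow> nat \<Rightarrow> bool" where
  "hop_within E 0 u w \<longleftrightarrow> u = w"
| "hop_within E (Suc k) u w \<longleftrightarrow> hop_within E k u w \<or> (\<exists>x. hop_within E k u x \<and> {x, w} \<in> E)"

definition gball :: "nat set set \<Rightarrow> nat \<Rightarrow> nat \<Rightarrow> nat set" where
  "gball E r v = {u. hop_within E r v u}"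

text \<open>Edges known to v after r rounds of LOCAL communication: those with an endpoint
  at distance less than r from v.\<close>
definition known_edges :: "nat set set \<Rightarrow> nat \<Rightarrow> nat \<Rightarrow> nat set set" where
  "known_edges E r v = {e\<in>E. 0 < r \<and> (\<exists>u\<in>e. u \<in> gball E (r - 1) v)}"

text \<open>The full information available at node v after r rounds: its ID, the known
  topology (with IDs), and the random inputs of all nodes within distance r.\<close>
type_synonym view = "nat \<times> nat set set \<times> (nat \<Rightarrow> real)"

definition local_view :: "nat set set \<Rightarrow> nat \<Rightarrow> (nat \<Rightarrow> real) \<Rightarrow> nat \<Rightarrow> view" where
  "local_view E r \<rho> v = (v, known_edges E r v, (\<lambda>u. if u \<in> gball E r v then \<rho> u else 0))"

text \<open>Output of an r-round LOCAL algorithm with local rule f: each node outputs its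
  partner (Some w) or None.\<close>
definition local_output ::
  "(view \<Rightarrow> nat option) \<Rightarrow> nat \<Rightarrow> nat set set \<Rightarrow> (nat \<Rightarrow> real) \<Rightarrow> nat \<Rightarrow> nat option" where
  "local_output f r E \<rho> v = f (local_view E r \<rho> v)"

definition consistent_output :: "nat set \<Rightarrow> nat set set \<Rightarrow> (nat \<Rightarrow> nat option) \<Rightarrow> bool" where
  "consistent_output V E out \<longleftrightarrow>
     (\<forall>v\<in>V. \<forall>w. out v = Some w \<longrightarrow> {v, w} \<in> E \<and> out w = Some v)"

definition output_matching :: "nat set \<Rightarrow> (nat \<Rightarrow> nat option) \<Rightarrow> nat set set" where
  "output_matching V out = {{v, w} | v w. v \<in> V \<and> out v = Some w}"

text \<open>Private randomness: each node gets an independent uniform real in [0,1]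
  (equivalent to an infinite string of fair coin flips).\<close>
definition rand_space :: "nat set \<Rightarrow> (nat \<Rightarrow> real) measure" where
  "rand_space V = PiM V (\<lambda>_. uniform_measure lborel {0..1::real})"

end

theory Submission
  imports Defs "HOL-Real_Asymp.Real_Asymp"
begin

text \<open>
  Every vertex splits its unit capacity among the balls \<open>B(w, i)\<close> that contain it, separately for each
  radius \<open>i \<le> R\<close>.  Every ball computes a maximal b-matching of its unmatched edges with respect to the
  capacities it was given, and a vertex multiplies by \<open>K\<close> the weight of each ball that used up its
  capacity (multiplicative weights).  Each round of this either gains a factor \<open>K\<close> for every edge or
  loads one of its endpoints, and a vertex of load \<open>y\<close> is matched with probability of order
  \<open>y / R^4\<close> when the fractional solutions are sampled.  So an edge \<open>uv\<close> dies after about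
  \<open>a / ln K\<close> steps of cost \<open>i\<close>, where \<open>a\<close> is the logarithm of the growth of the balls around
  \<open>u\<close>, \<open>v\<close> from radius \<open>i - 1\<close> to radius \<open>i\<close>.  These growths add up to at most
  \<open>2 ln n\<close> over \<open>i \<le> R\<close>; since the harmonic sum up to \<open>R\<close> is at least \<open>ln R\<close>, some radius has
  \<open>i a \<le> 2 ln n / ln R\<close>.  With \<open>K = R\<close> a small power of \<open>ln n\<close> this costs
  \<open>O(ln n / (ln ln n)^2)\<close> rounds.  All radii run in parallel and are read off by a single random choice
  of each vertex, so no vertex needs to know its good radius.  Markov's inequality for the edges of a
  maximum matching that survive gives the approximation ratio.
\<close>

section \<open>Distances and balls\<close>

lemma finite_edges: "simple_graph V E \<Longrightarrow> finite E"
  unfolding simple_graph_def by (meson Pow_iff finite_Pow_iff finite_subset subsetI)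

lemma hop_within_le: "hop_within E j u w \<Longrightarrow> j \<le> k \<Longrightarrow> hop_within E k u w"
  by (induction k) (auto simp: le_Suc_eq)

lemma hop_within_trans: "hop_within E j u w \<Longrightarrow> hop_within E k w x \<Longrightarrow> hop_within E (j + k) u x"
  by (induction k arbitrary: x) auto

lemma hop_within_edge: "{u, w} \<in> E \<Longrightarrow> hop_within E (Suc 0) u w"
  by auto

lemma hop_within_sym: "hop_within E k u w \<Longrightarrow> hop_within E k w u"
proof (induction k arbitrary: w)
  case (Suc k)
  show ?case
  proof (cases "hop_within E k u w")
    case True
    then show ?thesis using Suc.IH by auto
  next
    case False
    then obtain x where x: "hop_within E k u x" "{x, w} \<in> E" using Suc.prems by auto
    have "hop_within E (Suc 0) w x" using x(2) by (intro hop_within_edge) (simp add: insert_commute)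
    from hop_within_trans[OF this Suc.IH[OF x(1)]] show ?thesis by simp
  qed
qed auto

lemma mem_gball_sym: "u \<in> gball E k w \<longleftrightarrow> w \<in> gball E k u"
  using hop_within_sym by (auto simp: gball_def)

lemma mem_gball_trans: "w \<in> gball E j u \<Longrightarrow> x \<in> gball E k w \<Longrightarrow> x \<in> gball E (j + k) u"
  using hop_within_trans by (auto simp: gball_def)

lemma gball_mono: "j \<le> k \<Longrightarrow> gball E j u \<subseteq> gball E k u"
  using hop_within_le by (auto simp: gball_def)

lemma self_in_gball [simp]: "u \<in> gball E k u"
  using gball_mono[of 0 k E u] by (auto simp: gball_def)

lemma gball_0: "gball E 0 u = {u}"
  by (auto simp: gball_def)

lemma gball_subset:
  assumes "simple_graph V E" "u \<in> V"
  shows "gball E k u \<subseteq> V"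
proof -
  have "hop_within E k u w \<Longrightarrow> w \<in> V" for w
    using assms by (induction k arbitrary: w) (auto simp: simple_graph_def)
  then show ?thesis by (auto simp: gball_def)
qed

lemma finite_gball:
  assumes "simple_graph V E"
  shows "finite (gball E k u)"
proof -
  have "hop_within E k u w \<Longrightarrow> w \<in> insert u V" for w
    using assms by (induction k arbitrary: w) (auto simp: simple_graph_def)
  then have "gball E k u \<subseteq> insert u V" by (auto simp: gball_def)
  then show ?thesis using assms finite_subset by (auto simp: simple_graph_def)
qed

text \<open>This puts the balls of radius \<open>i - 1\<close> around both ends of an edge inside
  the intersection of their balls of radius \<open>i\<close>, the set of balls that work on that
  edge.\<close>

lemma edge_gball: "{u, v} \<in> E \<Longrightarrow> gball E k u \<subseteq> gball E (Suc k) v"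
  using mem_gball_trans[of u E "Suc 0" v _ k] hop_within_edge[of v u E]
  by (auto simp: gball_def insert_commute)

section \<open>Maximal b-matchings\<close>

definition edeg :: "nat set set \<Rightarrow> (nat set \<Rightarrow> nat) \<Rightarrow> nat \<Rightarrow> nat" where
  "edeg F x u = (\<Sum>e\<in>{e\<in>F. u \<in> e}. x e)"

text \<open>Edges may be taken with multiplicity. A saturated end at every edge is exactly what
  prevents raising any multiplicity.\<close>

definition maximal_bmatching :: "nat set set \<Rightarrow> (nat \<Rightarrow> nat) \<Rightarrow> (nat set \<Rightarrow> nat) \<Rightarrow> bool" where
  "maximal_bmatching F c x \<longleftrightarrow>
     (\<forall>u. edeg F x u \<le> c u) \<and> (\<forall>e\<in>F. \<exists>u\<in>e. edeg F x u = c u)"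

text \<open>A fixed choice depending on edges and capacities alone, so all vertices that know the
  same ball compute the same b-matching without further communication.\<close>

definition bmatching :: "nat set set \<Rightarrow> (nat \<Rightarrow> nat) \<Rightarrow> nat set \<Rightarrow> nat" where
  "bmatching F c = (SOME x. maximal_bmatching F c x)"

text \<open>Greedy construction: each new edge gets the smallest residual capacity of its ends,
  which saturates one of them and leaves saturated vertices saturated.\<close>

lemma maximal_bmatching_exists:
  assumes "finite F" "\<And>e. e \<in> F \<Longrightarrow> finite e \<and> e \<noteq> {}"
  shows "\<exists>x. maximal_bmatching F c x"
  using assms
proof (induction F)
  case empty
  then show ?case by (auto simp: maximal_bmatching_def edeg_def)
next
  case (insert e F)
  then obtain x where x: "maximal_bmatching F c x" by auto
  define r where "r = Min ((\<lambda>u. c u - edeg F x u) ` e)"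
  define y where "y = x(e := r)"
  have e: "finite e" "e \<noteq> {}" using insert.prems by auto
  have old: "edeg F y u = edeg F x u" for u
    using insert.hyps unfolding edeg_def y_def by (intro sum.cong) auto
  have new: "edeg (insert e F) y u = edeg F x u + (if u \<in> e then r else 0)" for u
  proof -
    have "{f \<in> insert e F. u \<in> f} = (if u \<in> e then insert e {f\<in>F. u \<in> f} else {f\<in>F. u \<in> f})"
      by auto
    then show ?thesis using insert.hyps old[of u] by (simp add: edeg_def y_def)
  qed
  have r_le: "r \<le> c u - edeg F x u" if "u \<in> e" for u
    unfolding r_def using e that by (intro Min_le) auto
  have "r \<in> (\<lambda>u. c u - edeg F x u) ` e" unfolding r_def using e by (intro Min_in) auto
  then obtain u where u: "u \<in> e" "r = c u - edeg F x u" by auto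
  have le: "edeg F x v \<le> c v" for v using x by (auto simp: maximal_bmatching_def)
  have "maximal_bmatching (insert e F) c y"
    unfolding maximal_bmatching_def
  proof (intro conjI allI ballI)
    fix v show "edeg (insert e F) y v \<le> c v" using new[of v] le[of v] r_le[of v] by (auto split: if_splits)
  next
    fix f assume "f \<in> insert e F"
    then show "\<exists>v\<in>f. edeg (insert e F) y v = c v"
    proof
      assume "f = e"
      then show ?thesis using u new[of u] le[of u] by (intro bexI[of _ u]) auto
    next
      assume "f \<in> F"
      then obtain v where "v \<in> f" "edeg F x v = c v" using x by (auto simp: maximal_bmatching_def)
      then show ?thesis using new[of v] r_le[of v] by (intro bexI[of _ v]) auto
    qed
  qed
  then show ?case by blast
qed

lemma maximal_bmatching_bmatching:
  assumes "finite F" "\<And>e. e \<in> F \<Longrightarrow> finite e \<and> e \<noteq> {}"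
  shows "maximal_bmatching F c (bmatching F c)"
  unfolding bmatching_def using maximal_bmatching_exists[OF assms] by (rule someI_ex)

section \<open>Reweighting of the balls around a vertex\<close>

definition cluster :: "nat set set \<Rightarrow> nat set \<Rightarrow> nat \<Rightarrow> nat \<Rightarrow> nat set set" where
  "cluster E A i w = {e\<in>E. e \<subseteq> A \<inter> gball E i w}"

definition wsum :: "nat \<Rightarrow> nat set set \<Rightarrow> nat \<Rightarrow> (nat \<Rightarrow> nat \<Rightarrow> nat) \<Rightarrow> nat \<Rightarrow> nat" where
  "wsum K E i m u = (\<Sum>w\<in>gball E i u. K ^ m u w)"

text \<open>The unit capacity of \<open>u\<close> is scaled to \<open>Q\<close>, so that the share
  of each ball can be rounded down to a natural number; this loses less than 1 per ball.\<close>

definition cap :: "nat \<Rightarrow> nat \<Rightarrow> nat set set \<Rightarrow> nat \<Rightarrow> (nat \<Rightarrow> nat \<Rightarrow> nat) \<Rightarrow> nat \<Rightarrow> nat \<Rightarrow> nat" where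
  "cap K Q E i m w u = (if w \<in> gball E i u then Q * K ^ m u w div wsum K E i m u else 0)"

definition cmatch :: "nat \<Rightarrow> nat \<Rightarrow> nat set set \<Rightarrow> nat set \<Rightarrow> nat \<Rightarrow> (nat \<Rightarrow> nat \<Rightarrow> nat) \<Rightarrow> nat \<Rightarrow> nat set \<Rightarrow> nat" where
  "cmatch K Q E A i m w = bmatching (cluster E A i w) (cap K Q E i m w)"

definition cload :: "nat \<Rightarrow> nat \<Rightarrow> nat set set \<Rightarrow> nat set \<Rightarrow> nat \<Rightarrow> (nat \<Rightarrow> nat \<Rightarrow> nat) \<Rightarrow> nat \<Rightarrow> nat \<Rightarrow> nat" where
  "cload K Q E A i m w u = edeg (cluster E A i w) (cmatch K Q E A i m w) u"

text \<open>A share rounded down to 0 counts as used up, so even a ball with a negligible share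
  gains weight.\<close>

definition reweight :: "nat \<Rightarrow> nat \<Rightarrow> nat set set \<Rightarrow> nat set \<Rightarrow> nat \<Rightarrow> (nat \<Rightarrow> nat \<Rightarrow> nat) \<Rightarrow> nat \<Rightarrow> nat \<Rightarrow> nat" where
  "reweight K Q E A i m = (\<lambda>u w.
     if w \<in> gball E i u \<and> cload K Q E A i m w u = cap K Q E i m w u then Suc (m u w) else m u w)"

text \<open>The b-matchings of all balls of radius \<open>i\<close> added up: \<open>Q\<close> times
  a fractional matching, since by \<open>sum_tokens\<close> and \<open>vload_le\<close> the tokens
  of a vertex total at most \<open>Q\<close>.\<close>

definition tokens :: "nat \<Rightarrow> nat \<Rightarrow> nat set set \<Rightarrow> nat set \<Rightarrow> nat \<Rightarrow> (nat \<Rightarrow> nat \<Rightarrow> nat) \<Rightarrow> nat \<Rightarrow> nat \<Rightarrow> nat" where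
  "tokens K Q E A i m u z =
     (\<Sum>w\<in>{w\<in>gball E i u. {u, z} \<in> cluster E A i w}. cmatch K Q E A i m w {u, z})"

definition vload :: "nat \<Rightarrow> nat \<Rightarrow> nat set set \<Rightarrow> nat set \<Rightarrow> nat \<Rightarrow> (nat \<Rightarrow> nat \<Rightarrow> nat) \<Rightarrow> nat \<Rightarrow> nat" where
  "vload K Q E A i m u = (\<Sum>w\<in>gball E i u. cload K Q E A i m w u)"

lemma cmatch_maximal:
  assumes "simple_graph V E"
  shows "maximal_bmatching (cluster E A i w) (cap K Q E i m w) (cmatch K Q E A i m w)"
  unfolding cmatch_def
proof (rule maximal_bmatching_bmatching)
  show "finite (cluster E A i w)" using finite_edges[OF assms] by (auto simp: cluster_def)
  fix e assume "e \<in> cluster E A i w"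
  then have "e \<in> E" by (auto simp: cluster_def)
  then show "finite e \<and> e \<noteq> {}" using assms by (auto simp: simple_graph_def intro: card_ge_0_finite)
qed

lemma cload_le_cap: "simple_graph V E \<Longrightarrow> cload K Q E A i m w u \<le> cap K Q E i m w u"
  using cmatch_maximal[of V E A i w K Q m] by (auto simp: maximal_bmatching_def cload_def)

lemma wsum_pos:
  assumes "simple_graph V E" "K > 0"
  shows "wsum K E i m u > 0"
  unfolding wsum_def using assms finite_gball[OF assms(1)]
  by (intro sum_pos) (auto intro: self_in_gball)

text \<open>The shares are proportional to the weights and normalised by their sum, so together they
  never exceed \<open>Q\<close>, and loads stay below shares.\<close>

lemma vload_le:
  assumes "simple_graph V E" "K > 0"
  shows "vload K Q E A i m u \<le> Q"
proof -
  let ?S = "wsum K E i m u"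
  have S: "?S > 0" by (rule wsum_pos[OF assms])
  have "vload K Q E A i m u \<le> (\<Sum>w\<in>gball E i u. Q * K ^ m u w div ?S)"
    unfolding vload_def
  proof (rule sum_mono)
    fix w assume "w \<in> gball E i u"
    then show "cload K Q E A i m w u \<le> Q * K ^ m u w div ?S"
      using cload_le_cap[OF assms(1), of K Q A i m w u] by (simp add: cap_def)
  qed
  also have "\<dots> * ?S \<le> (\<Sum>w\<in>gball E i u. Q * K ^ m u w)"
    unfolding sum_distrib_right by (intro sum_mono) (simp add: mult.commute)
  also have "\<dots> = Q * ?S" by (simp add: wsum_def sum_distrib_left)
  finally show ?thesis using S by (simp add: mult_le_mono1)
qed

text \<open>A ball contributes to an edge only if it contains both ends, so the two ends count the
  same balls.\<close>

lemma tokens_sym: 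
  "tokens K Q E A i m u z = tokens K Q E A i m z u"
proof -
  have "{w\<in>gball E i u. {u, z} \<in> cluster E A i w} = {w\<in>gball E i z. {z, u} \<in> cluster E A i w}"
    using mem_gball_sym[of u E i] mem_gball_sym[of z E i] by (auto simp: cluster_def insert_commute)
  then show ?thesis unfolding tokens_def by (simp add: insert_commute)
qed

lemma tokens_pos_edge:
  assumes "tokens K Q E A i m u z \<noteq> 0"
  shows "{u, z} \<in> E" "u \<in> A" "z \<in> A"
proof -
  have "{w\<in>gball E i u. {u, z} \<in> cluster E A i w} \<noteq> {}"
    using assms unfolding tokens_def by (metis sum.empty)
  then show "{u, z} \<in> E" "u \<in> A" "z \<in> A" by (auto simp: cluster_def)
qed

text \<open>Double counting: neighbours \<open>z\<close> of \<open>u\<close> correspond to edges at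
  \<open>u\<close>, and the sums over balls and over neighbours are exchanged.\<close>

lemma sum_tokens:
  assumes G: "simple_graph V E"
  shows "(\<Sum>z\<in>V. tokens K Q E A i m u z) = vload K Q E A i m u"
proof -
  have V: "finite V" using G by (auto simp: simple_graph_def)
  have B: "finite (gball E i u)" by (rule finite_gball[OF G])
  have "cload K Q E A i m w u
     = (\<Sum>z\<in>{z\<in>V. {u, z} \<in> cluster E A i w}. cmatch K Q E A i m w {u, z})" for w
    unfolding cload_def edeg_def
  proof (rule sum.reindex_bij_betw[symmetric])
    show "bij_betw (\<lambda>z. {u, z}) {z \<in> V. {u, z} \<in> cluster E A i w} {e \<in> cluster E A i w. u \<in> e}"
      unfolding bij_betw_def
    proof (intro conjI)
      show "inj_on (\<lambda>z. {u, z}) {z \<in> V. {u, z} \<in> cluster E A i w}"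
        by (auto simp: inj_on_def doubleton_eq_iff)
      show "(\<lambda>z. {u, z}) ` {z \<in> V. {u, z} \<in> cluster E A i w} = {e \<in> cluster E A i w. u \<in> e}"
      proof
        show "{e \<in> cluster E A i w. u \<in> e} \<subseteq> (\<lambda>z. {u, z}) ` {z \<in> V. {u, z} \<in> cluster E A i w}"
        proof
          fix e assume e: "e \<in> {e \<in> cluster E A i w. u \<in> e}"
          then have "e \<in> E" by (auto simp: cluster_def)
          then have "card e = 2" "e \<subseteq> V" using G by (auto simp: simple_graph_def)
          then obtain z where "e = {u, z}" using e by (auto simp: card_2_iff)
          then show "e \<in> (\<lambda>z. {u, z}) ` {z \<in> V. {u, z} \<in> cluster E A i w}"
            using e \<open>e \<subseteq> V\<close> by auto
        qed
      qed auto
    qed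
  qed
  then have "vload K Q E A i m u = (\<Sum>w\<in>gball E i u. \<Sum>z\<in>V.
      if {u, z} \<in> cluster E A i w then cmatch K Q E A i m w {u, z} else 0)"
    unfolding vload_def using V by (simp add: sum.inter_filter)
  also have "\<dots> = (\<Sum>z\<in>V. \<Sum>w\<in>gball E i u.
      if {u, z} \<in> cluster E A i w then cmatch K Q E A i m w {u, z} else 0)"
    by (rule sum.swap)
  also have "\<dots> = (\<Sum>z\<in>V. tokens K Q E A i m u z)"
    unfolding tokens_def using B by (simp add: sum.inter_filter)
  finally show ?thesis by simp
qed

text \<open>Weight grows only at balls that used up their share, and there the weight is at most a
  fraction \<open>(load + 1) / Q\<close> of the total. So the logarithmic growth is paid for by the
  load of \<open>u\<close>; the term \<open>card V\<close> is the loss from rounding.\<close>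

lemma ln_wsum_reweight:
  assumes G: "simple_graph V E" and u: "u \<in> V" and K: "K > 0" and Q: "Q > 0"
  shows "ln (real (wsum K E i (reweight K Q E A i m) u))
     \<le> ln (real (wsum K E i m u)) + real K * (real (vload K Q E A i m u) + real (card V)) / real Q"
proof -
  let ?B = "gball E i u" and ?S = "wsum K E i m u"
  let ?Y = "vload K Q E A i m u"
  define T where "T = {w\<in>?B. cload K Q E A i m w u = cap K Q E i m w u}"
  have B: "finite ?B" "?B \<subseteq> V" using finite_gball[OF G] gball_subset[OF G u] by auto
  have V: "finite V" using G by (auto simp: simple_graph_def)
  have S: "?S > 0" by (rule wsum_pos[OF G K])
  have T: "T \<subseteq> ?B" "finite T" using B by (auto simp: T_def)
  \<comment> \<open>A share is the floor of a quotient, hence the \<open>+ 1\<close>.\<close>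
  have one: "Q * K ^ m u w \<le> (cload K Q E A i m w u + 1) * ?S" if "w \<in> T" for w
  proof -
    have "cload K Q E A i m w u = Q * K ^ m u w div ?S" using that by (auto simp: T_def cap_def)
    then show ?thesis using dividend_less_div_times[OF S, of "Q * K ^ m u w"] by simp
  qed
  have "Q * (\<Sum>w\<in>T. K ^ m u w) \<le> (\<Sum>w\<in>T. cload K Q E A i m w u + 1) * ?S"
    unfolding sum_distrib_left sum_distrib_right by (intro sum_mono one)
  also have "(\<Sum>w\<in>T. cload K Q E A i m w u + 1) = (\<Sum>w\<in>T. cload K Q E A i m w u) + card T"
    by (subst sum.distrib) simp
  also have "\<dots> \<le> ?Y + card V"
    unfolding vload_def using T B V by (intro add_mono sum_mono2 card_mono) auto
  finally have a: "Q * (\<Sum>w\<in>T. K ^ m u w) \<le> (?Y + card V) * ?S" by (simp add: mult_le_mono1)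
  have "wsum K E i (reweight K Q E A i m) u
      = (\<Sum>w\<in>?B. K ^ m u w + (if w \<in> T then (K - 1) * K ^ m u w else 0))"
    unfolding wsum_def reweight_def T_def using K
    by (intro sum.cong) (auto simp: algebra_simps simp flip: add_mult_distrib)
  also have "\<dots> = ?S + (K - 1) * (\<Sum>w\<in>T. K ^ m u w)"
  proof -
    have "(\<Sum>w\<in>?B. if w \<in> T then (K - 1) * K ^ m u w else 0) = (\<Sum>w\<in>T. (K - 1) * K ^ m u w)"
      using B T by (subst sum.inter_restrict[symmetric]) (auto simp: Int_absorb1)
    then show ?thesis by (simp add: sum.distrib wsum_def sum_distrib_left)
  qed
  finally have b: "wsum K E i (reweight K Q E A i m) u = ?S + (K - 1) * (\<Sum>w\<in>T. K ^ m u w)" .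
  define t where "t = real K * (real ?Y + real (card V)) / real Q"
  have "real (\<Sum>w\<in>T. K ^ m u w) \<le> (real ?Y + real (card V)) * real ?S / real Q"
    using a Q unfolding of_nat_le_iff[where 'a=real, symmetric] by (simp add: field_simps)
  moreover have "real (K - 1) \<le> real K" by simp
  ultimately have "real (K - 1) * real (\<Sum>w\<in>T. K ^ m u w)
      \<le> real K * ((real ?Y + real (card V)) * real ?S / real Q)"
    by (intro mult_mono) (auto intro: sum_nonneg)
  also have "\<dots> = t * real ?S" by (simp add: t_def)
  finally have "real (wsum K E i (reweight K Q E A i m) u) \<le> real ?S * (1 + t)"
    unfolding b of_nat_add of_nat_mult by (simp add: ring_distribs mult.commute del: of_nat_diff of_nat_sum)
  also have "\<dots> \<le> real ?S * exp t" using S exp_ge_add_one_self[of t] by (intro mult_left_mono) auto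
  finally have c: "real (wsum K E i (reweight K Q E A i m) u) \<le> real ?S * exp t" .
  have "wsum K E i (reweight K Q E A i m) u > 0" by (rule wsum_pos[OF G K])
  then have "ln (real (wsum K E i (reweight K Q E A i m) u)) \<le> ln (real ?S * exp t)"
    using c by (intro ln_mono) auto
  also have "\<dots> = ln (real ?S) + t" using S by (simp add: ln_mult)
  finally show ?thesis by (simp add: t_def)
qed

text \<open>Maximality saturates an end of each edge of the ball; which end is unknown, so only the
  sum of both exponents is controlled.\<close>

lemma reweight_edge:
  assumes G: "simple_graph V E" and e: "{u, v} \<in> E" "u \<in> A" "v \<in> A"
    and w: "w \<in> gball E i u \<inter> gball E i v"
  shows "m u w + m v w + 1 \<le> reweight K Q E A i m u w + reweight K Q E A i m v w"
proof -
  have "{u, v} \<in> cluster E A i w" using e w mem_gball_sym by (auto simp: cluster_def)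
  then have "cload K Q E A i m w u = cap K Q E i m w u \<or> cload K Q E A i m w v = cap K Q E i m w v"
    using cmatch_maximal[OF G, of A i w K Q m] by (auto simp: maximal_bmatching_def cload_def)
  then show ?thesis using w by (auto simp: reweight_def)
qed

text \<open>A lower bound for the weights by the Cauchy-Schwarz inequality, as only the sums of the exponents
  at the two ends of an edge are known to grow.\<close>
lemma wsum_prod_ge:
  assumes G: "simple_graph V E" and K: "K > 0"
    and W: "W = gball E i u \<inter> gball E i v"
    and a: "\<And>w. w \<in> W \<Longrightarrow> a \<le> m u w + m v w"
  shows "(real (card W))\<^sup>2 * real K ^ a \<le> real (wsum K E i m u) * real (wsum K E i m v)"
proof -
  have fin: "finite (gball E i u)" "finite (gball E i v)" by (rule finite_gball[OF G])+
  let ?f = "\<lambda>w. sqrt (real K ^ m u w)" and ?g = "\<lambda>w. sqrt (real K ^ m v w)"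
  have "real (card W) * sqrt (real K ^ a) \<le> (\<Sum>w\<in>W. ?f w * ?g w)"
    using a K by (subst sum_bounded_below) (auto simp: real_sqrt_mult[symmetric] power_add[symmetric]
        intro!: power_increasing sum_bounded_below)
  then have "(real (card W) * sqrt (real K ^ a))\<^sup>2 \<le> (\<Sum>w\<in>W. ?f w * ?g w)\<^sup>2"
    by (intro power_mono) auto
  also have "\<dots> \<le> (\<Sum>w\<in>W. (?f w)\<^sup>2) * (\<Sum>w\<in>W. (?g w)\<^sup>2)"
    by (rule Cauchy_Schwarz_ineq_sum)
  also have "\<dots> = (\<Sum>w\<in>W. real K ^ m u w) * (\<Sum>w\<in>W. real K ^ m v w)" by simp
  also have "\<dots> \<le> real (wsum K E i m u) * real (wsum K E i m v)"
    unfolding wsum_def of_nat_sum of_nat_power using fin W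
    by (intro mult_mono sum_mono2 sum_nonneg) auto
  finally show ?thesis by (simp add: power_mult_distrib)
qed

section \<open>Token assignment\<close>

text \<open>A fixed assignment of the token numbers below \<open>Q\<close> under which a uniformly
  random token selects \<open>z\<close> with probability \<open>X z / Q\<close>; leftover tokens
  select nobody.\<close>

definition token_target :: "nat \<Rightarrow> (nat \<Rightarrow> nat) \<Rightarrow> nat \<Rightarrow> nat option" where
  "token_target Q X = (SOME f. \<forall>z. card {t. t < Q \<and> f t = Some z} = X z)"

lemma token_target_exists:
  assumes "finite V" "\<And>z. z \<notin> V \<Longrightarrow> X z = 0" "(\<Sum>z\<in>V. X z) \<le> Q"
  shows "\<exists>f. \<forall>z. card {t. t < Q \<and> f t = Some z} = X z"
proof -
  \<comment> \<open>The induction also records that all tokens from the current total on are free: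
    the next vertex receives the next block.\<close>
  have "\<exists>f. (\<forall>z. card {t. t < Q \<and> f t = Some z} = (if z \<in> W then X z else 0)) \<and>
             (\<forall>t\<ge>(\<Sum>z\<in>W. X z). f t = None)" if "finite W" "(\<Sum>z\<in>W. X z) \<le> Q" for W
    using that
  proof (induction W)
    case empty
    then show ?case by (intro exI[of _ "\<lambda>_. None"]) auto
  next
    case (insert a W)
    let ?s = "\<Sum>z\<in>W. X z"
    have "(\<Sum>z\<in>W. X z) \<le> Q" using insert.prems insert.hyps by simp
    then obtain f where f: "\<And>z. card {t. t < Q \<and> f t = Some z} = (if z \<in> W then X z else 0)"
      "\<And>t. t \<ge> ?s \<Longrightarrow> f t = None" using insert.IH by blast
    define g where "g t = (if t \<in> {?s..<?s + X a} then Some a else f t)" for t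
    have le: "?s + X a \<le> Q" using insert by simp
    have "card {t. t < Q \<and> g t = Some z} = (if z \<in> insert a W then X z else 0)" for z
    proof (cases "z = a")
      case True
      have "{t. t < Q \<and> f t = Some a} = {}" using f(1)[of a] insert.hyps(2) by simp
      then have "{t. t < Q \<and> g t = Some z} = {?s..<?s + X a}"
        using True le by (auto simp: g_def)
      then show ?thesis using True by simp
    next
      case False
      then have "{t. t < Q \<and> g t = Some z} = {t. t < Q \<and> f t = Some z}"
        using f(2) by (auto simp: g_def)
      then show ?thesis using False f(1)[of z] by simp
    qed
    moreover have "g t = None" if "t \<ge> (\<Sum>z\<in>insert a W. X z)" for t
      using that insert.hyps f(2)[of t] by (auto simp: g_def)
    ultimately show ?case by blast
  qed
  from this[OF assms(1,3)] obtain f where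
    "\<And>z. card {t. t < Q \<and> f t = Some z} = (if z \<in> V then X z else 0)" by blast
  then have "\<forall>z. card {t. t < Q \<and> f t = Some z} = X z" using assms(2) by simp
  then show ?thesis by blast
qed

lemma card_token_target:
  assumes "simple_graph V E" "K > 0"
  shows "card {t. t < Q \<and> token_target Q (tokens K Q E A i m z) t = Some u} = tokens K Q E A i m z u"
proof -
  have "\<exists>f. \<forall>x. card {t. t < Q \<and> f t = Some x} = tokens K Q E A i m z x"
  proof (rule token_target_exists)
    show "finite V" using assms by (auto simp: simple_graph_def)
    show "x \<notin> V \<Longrightarrow> tokens K Q E A i m z x = 0" for x
      using tokens_pos_edge(1)[of K Q E A i m z x] assms(1) unfolding simple_graph_def by blast
    show "(\<Sum>x\<in>V. tokens K Q E A i m z x) \<le> Q"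
      unfolding sum_tokens[OF assms(1)] by (rule vload_le[OF assms])
  qed
  then have "\<forall>x. card {t. t < Q \<and> token_target Q (tokens K Q E A i m z) t = Some x} = tokens K Q E A i m z x"
    unfolding token_target_def by (rule someI_ex)
  then show ?thesis by blast
qed

section \<open>One phase of the algorithm\<close>

type_synonym draw = "nat \<times> nat \<times> bool \<times> nat"
type_synonym state = "(nat \<Rightarrow> nat option) \<times> (nat \<Rightarrow> nat \<Rightarrow> nat \<Rightarrow> nat)"

definition unmatched :: "(nat \<Rightarrow> nat option) \<Rightarrow> nat set" where
  "unmatched P = {u. P u = None}"

text \<open>\<open>snd \<sigma> i u w\<close> is the exponent of \<open>K\<close> in the weight that \<open>u\<close> gives to the ball of radius \<open>i\<close>
  around \<open>w\<close>; within a phase, the set of unmatched vertices stays fixed and radius \<open>i\<close> makes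
  \<open>R div i\<close> steps, so that all radii need the same number of rounds.\<close>
definition weights :: "nat \<Rightarrow> nat \<Rightarrow> nat set set \<Rightarrow> state \<Rightarrow> nat \<Rightarrow> nat \<Rightarrow> nat \<Rightarrow> nat \<Rightarrow> nat" where
  "weights K Q E \<sigma> i s = (reweight K Q E (unmatched (fst \<sigma>)) i ^^ s) (snd \<sigma> i)"

text \<open>A draw consists of a radius, a step of the phase, a role and a token.  As it names a single
  step, the roles of a vertex in different steps never conflict.\<close>
definition draws :: "nat \<Rightarrow> nat \<Rightarrow> draw set" where
  "draws R Q = {1..R} \<times> {..<R} \<times> UNIV \<times> {..<Q}"

fun slot :: "draw \<Rightarrow> nat \<times> nat" where
  "slot (i, s, _, _) = (i, s)"

fun accepts :: "draw \<Rightarrow> bool" where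
  "accepts (_, _, a, _) = a"

fun token :: "draw \<Rightarrow> nat" where
  "token (_, _, _, t) = t"

text \<open>Slots with \<open>s \<ge> R div i\<close> are void because radius \<open>i\<close> makes
  only \<open>R div i\<close> steps in a phase.\<close>

definition proposal :: "nat \<Rightarrow> nat \<Rightarrow> nat \<Rightarrow> nat set set \<Rightarrow> state \<Rightarrow> draw \<Rightarrow> nat \<Rightarrow> nat option" where
  "proposal K Q R E \<sigma> x z =
     (let (i, s) = slot x in
      if accepts x \<or> s \<ge> R div i then None
      else token_target Q (tokens K Q E (unmatched (fst \<sigma>)) i (weights K Q E \<sigma> i s) z) (token x))"

definition proposers :: "nat \<Rightarrow> nat \<Rightarrow> nat \<Rightarrow> nat set set \<Rightarrow> state \<Rightarrow> (nat \<Rightarrow> draw) \<Rightarrow> nat \<Rightarrow> nat set" where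
  "proposers K Q R E \<sigma> d u =
     {z. {z, u} \<in> E \<and> z \<in> unmatched (fst \<sigma>) \<and> slot (d z) = slot (d u) \<and> proposal K Q R E \<sigma> (d z) z = Some u}"

text \<open>An acceptor takes its least proposer in the same slot, and a proposer checks whether it
  is that least one for its target; the two sides evaluate the same rule.\<close>

definition partner :: "nat \<Rightarrow> nat \<Rightarrow> nat \<Rightarrow> nat set set \<Rightarrow> state \<Rightarrow> (nat \<Rightarrow> draw) \<Rightarrow> nat \<Rightarrow> nat option" where
  "partner K Q R E \<sigma> d u =
    (if fst \<sigma> u \<noteq> None then fst \<sigma> u
     else if accepts (d u)
     then (if proposers K Q R E \<sigma> d u = {} then None else Some (Min (proposers K Q R E \<sigma> d u)))
     else (case proposal K Q R E \<sigma> (d u) u of None \<Rightarrow> None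
           | Some a \<Rightarrow> if a \<in> unmatched (fst \<sigma>) \<and> accepts (d a) \<and> u \<in> proposers K Q R E \<sigma> d a
                          \<and> u = Min (proposers K Q R E \<sigma> d a) then Some a else None))"

definition phase :: "nat \<Rightarrow> nat \<Rightarrow> nat \<Rightarrow> nat set set \<Rightarrow> (nat \<Rightarrow> draw) \<Rightarrow> state \<Rightarrow> state" where
  "phase K Q R E d \<sigma> = (partner K Q R E \<sigma> d, \<lambda>i. weights K Q E \<sigma> i (R div i))"

fun run :: "nat \<Rightarrow> nat \<Rightarrow> nat \<Rightarrow> nat set set \<Rightarrow> nat \<Rightarrow> (nat \<Rightarrow> draw list) \<Rightarrow> state \<Rightarrow> state" where
  "run K Q R E 0 \<omega> \<sigma> = \<sigma>"
| "run K Q R E (Suc k) \<omega> \<sigma> = run K Q R E k (\<lambda>u. tl (\<omega> u)) (phase K Q R E (\<lambda>u. hd (\<omega> u)) \<sigma>)"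

definition initial :: state where
  "initial = (\<lambda>_. None, \<lambda>_ _ _. 0)"

definition proper :: "nat set set \<Rightarrow> (nat \<Rightarrow> nat option) \<Rightarrow> bool" where
  "proper E P \<longleftrightarrow> (\<forall>u a. P u = Some a \<longrightarrow> {u, a} \<in> E \<and> P a = Some u)"

lemma finite_proposers: "simple_graph V E \<Longrightarrow> finite (proposers K Q R E \<sigma> d u)"
proof -
  assume G: "simple_graph V E"
  have "proposers K Q R E \<sigma> d u \<subseteq> V" using G by (auto simp: proposers_def simple_graph_def)
  then show ?thesis using G finite_subset by (auto simp: simple_graph_def)
qed

text \<open>A single draw fixes one role: an acceptor makes no proposal, and a proposer has a single
  target. So the choice made by the acceptor is confirmed by the proposer and conversely.\<close>

lemma proper_phase:
  assumes G: "simple_graph V E" and P: "proper E (fst \<sigma>)"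
  shows "proper E (fst (phase K Q R E d \<sigma>))"
  unfolding proper_def
proof (intro allI impI)
  let ?Pr = "proposers K Q R E \<sigma> d"
  let ?p = "partner K Q R E \<sigma> d"
  fix u a assume "fst (phase K Q R E d \<sigma>) u = Some a"
  then have ua: "?p u = Some a" by (simp add: phase_def)
  have "{u, a} \<in> E \<and> ?p a = Some u"
  proof (cases "fst \<sigma> u = None")
    case False
    then have "fst \<sigma> u = Some a" using ua by (auto simp: partner_def)
    then have "{u, a} \<in> E" "fst \<sigma> a = Some u" using P unfolding proper_def by blast+
    then show ?thesis by (simp add: partner_def)
  next
    case u: True
    show ?thesis
    proof (cases "accepts (d u)")
      case True
      then have a: "?Pr u \<noteq> {}" "a = Min (?Pr u)"
        using ua u unfolding partner_def by (simp_all split: if_splits)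
      then have "a \<in> ?Pr u" using finite_proposers[OF G] Min_in by blast
      then have *: "{a, u} \<in> E" "fst \<sigma> a = None" "proposal K Q R E \<sigma> (d a) a = Some u"
        by (auto simp: proposers_def unmatched_def)
      then have "\<not> accepts (d a)" by (auto simp: proposal_def split: prod.splits if_splits)
      then have "?p a = Some u"
        unfolding partner_def using *(2,3) a(2)[symmetric] \<open>a \<in> ?Pr u\<close> True u by (simp add: unmatched_def)
      then show ?thesis using * by (simp add: insert_commute)
    next
      case False
      then have *: "a \<in> unmatched (fst \<sigma>)" "accepts (d a)" "u \<in> ?Pr a" "Min (?Pr a) = u"
        using ua u unfolding partner_def by (simp_all split: option.splits if_splits)
      then have "?p a = Some u" unfolding partner_def by (auto simp: unmatched_def)
      then show ?thesis using * by (auto simp: proposers_def)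
    qed
  qed
  then show "{u, a} \<in> E \<and> fst (phase K Q R E d \<sigma>) a = Some u" by (simp add: phase_def)
qed

lemma proper_run:
  assumes "simple_graph V E" "proper E (fst \<sigma>)"
  shows "proper E (fst (run K Q R E k \<omega> \<sigma>))"
  using assms(2)
proof (induction k arbitrary: \<omega> \<sigma>)
  case (Suc k)
  show ?case unfolding run.simps by (intro Suc.IH proper_phase[OF assms(1)] Suc.prems)
qed simp

text \<open>Used to conclude that an edge alive at the end was alive in every earlier phase.\<close>

lemma run_matched: "fst \<sigma> u \<noteq> None \<Longrightarrow> fst (run K Q R E k \<omega> \<sigma>) u \<noteq> None"
proof (induction k arbitrary: \<omega> \<sigma>)
  case (Suc k)
  have "fst (phase K Q R E (\<lambda>u. hd (\<omega> u)) \<sigma>) u \<noteq> None"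
    using Suc.prems by (simp add: phase_def partner_def)
  then show ?case using Suc.IH by simp
qed simp

section \<open>Locality\<close>

text \<open>Two instances that look alike from \<open>z\<close> up to distance \<open>k\<close>. The
  strict \<open>j < k\<close> for edges matches \<open>known_edges\<close>: \<open>k\<close> rounds
  reveal the edges at vertices closer than \<open>k\<close>.\<close>

definition agree :: "nat set set \<Rightarrow> nat set set \<Rightarrow> (nat \<Rightarrow> 'a) \<Rightarrow> (nat \<Rightarrow> 'a) \<Rightarrow> nat \<Rightarrow> nat \<Rightarrow> bool" where
  "agree E1 E2 \<omega>1 \<omega>2 k z \<longleftrightarrow>
     (\<forall>j\<le>k. gball E1 j z = gball E2 j z) \<and>
     (\<forall>j<k. \<forall>u\<in>gball E1 j z. \<forall>e. u \<in> e \<longrightarrow> (e \<in> E1 \<longleftrightarrow> e \<in> E2)) \<and>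
     (\<forall>u\<in>gball E1 k z. \<omega>1 u = \<omega>2 u)"

lemma gball_Suc: "gball E (Suc k) u = gball E k u \<union> {w. \<exists>x\<in>gball E k u. {x, w} \<in> E}"
  by (auto simp: gball_def)

lemma gball_eq_local:
  assumes "\<forall>j<k. \<forall>u\<in>gball E1 j z. \<forall>e. u \<in> e \<longrightarrow> (e \<in> E1 \<longleftrightarrow> e \<in> E2)" "j \<le> k"
  shows "gball E1 j z = gball E2 j z"
  using assms(2)
proof (induction j)
  case (Suc j)
  then have "gball E1 j z = gball E2 j z" by simp
  moreover have "{x, w} \<in> E1 \<longleftrightarrow> {x, w} \<in> E2" if "x \<in> gball E1 j z" for x w
    using assms(1) that Suc.prems by (metis Suc_le_lessD insertI1)
  ultimately show ?case unfolding gball_Suc by blast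
qed (simp add: gball_0)

lemma agree_I:
  assumes "\<And>j u e. j < k \<Longrightarrow> u \<in> gball E1 j z \<Longrightarrow> u \<in> e \<Longrightarrow> e \<in> E1 \<longleftrightarrow> e \<in> E2"
    "\<And>u. u \<in> gball E1 k z \<Longrightarrow> \<omega>1 u = \<omega>2 u"
  shows "agree E1 E2 \<omega>1 \<omega>2 k z"
  unfolding agree_def using assms gball_eq_local[of k E1 z E2] by blast

lemma agree_gball: "agree E1 E2 \<omega>1 \<omega>2 k z \<Longrightarrow> j \<le> k \<Longrightarrow> gball E1 j z = gball E2 j z"
  by (auto simp: agree_def)

lemma agree_edge: "agree E1 E2 \<omega>1 \<omega>2 k z \<Longrightarrow> 0 < k \<Longrightarrow> z \<in> e \<Longrightarrow> e \<in> E1 \<longleftrightarrow> e \<in> E2"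
  unfolding agree_def using self_in_gball by blast

text \<open>Triangle inequality; each locality bound below spends part of the radius in this
  way.\<close>

lemma agree_sub:
  assumes "agree E1 E2 \<omega>1 \<omega>2 (j + k) z" "u \<in> gball E1 j z"
  shows "agree E1 E2 \<omega>1 \<omega>2 k u"
proof (rule agree_I)
  fix l w e assume "l < k" "w \<in> gball E1 l u" "w \<in> e"
  then have "w \<in> gball E1 (j + l) z" "j + l < j + k" using mem_gball_trans[OF assms(2)] by auto
  then show "e \<in> E1 \<longleftrightarrow> e \<in> E2" using assms(1) \<open>w \<in> e\<close> unfolding agree_def by blast
next
  fix w assume "w \<in> gball E1 k u"
  then have "w \<in> gball E1 (j + k) z" using mem_gball_trans[OF assms(2)] by auto
  then show "\<omega>1 w = \<omega>2 w" using assms(1) unfolding agree_def by blast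
qed

lemma agree_mono: "agree E1 E2 \<omega>1 \<omega>2 k z \<Longrightarrow> j \<le> k \<Longrightarrow> agree E1 E2 \<omega>1 \<omega>2 j z"
  using agree_sub[of E1 E2 \<omega>1 \<omega>2 "k - j" j z z] by simp

section \<open>Radius spent by each ingredient of a phase\<close>

context
  fixes E1 E2 :: "nat set set"
  assumes E1: "\<And>e. e \<in> E1 \<Longrightarrow> e \<noteq> {}" and E2: "\<And>e. e \<in> E2 \<Longrightarrow> e \<noteq> {}"
begin

text \<open>An edge inside the ball has an end, and around it the graphs agree to the positive
  radius \<open>k\<close>, hence on that edge. This is where nonempty edges enter.\<close>

lemma cluster_local:
  assumes k: "0 < k" and A: "\<And>z. agree E1 E2 \<omega>1 \<omega>2 k z \<Longrightarrow> z \<in> A1 \<longleftrightarrow> z \<in> A2"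
    and w: "agree E1 E2 \<omega>1 \<omega>2 (i + k) w"
  shows "cluster E1 A1 i w = cluster E2 A2 i w"
proof -
  have B: "gball E1 i w = gball E2 i w" using w by (intro agree_gball) auto
  have *: "agree E1 E2 \<omega>1 \<omega>2 k u" if "u \<in> gball E1 i w" for u
    using agree_sub[OF w that] .
  have "e \<in> E1 \<longleftrightarrow> e \<in> E2" if "e \<subseteq> gball E1 i w" for e
  proof (cases "e = {}")
    case False
    then obtain u where "u \<in> e" by auto
    then show ?thesis using agree_edge[OF *[of u] k, of e] that by auto
  qed (use E1 E2 in auto)
  then show ?thesis using A * B unfolding cluster_def by blast
qed

lemma cap_local:
  assumes k: "0 < k" and m: "\<And>z. agree E1 E2 \<omega>1 \<omega>2 k z \<Longrightarrow> m1 z = m2 z"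
    and w: "agree E1 E2 \<omega>1 \<omega>2 (2 * i + k) w"
  shows "cap K Q E1 i m1 w = cap K Q E2 i m2 w"
proof
  fix u
  have B: "gball E1 i w = gball E2 i w" using w by (intro agree_gball) auto
  have iff: "w \<in> gball E1 i u \<longleftrightarrow> w \<in> gball E2 i u"
    using B mem_gball_sym by blast
  show "cap K Q E1 i m1 w u = cap K Q E2 i m2 w u"
  proof (cases "w \<in> gball E1 i u")
    case True
    then have "u \<in> gball E1 i w" using mem_gball_sym by blast
    then have u: "agree E1 E2 \<omega>1 \<omega>2 (i + k) u" using agree_sub[of E1 E2 \<omega>1 \<omega>2 i "i + k" w] w
      by (simp add: mult_2 add.assoc)
    have "m1 u = m2 u" using m agree_mono[OF u] by simp
    moreover have "gball E1 i u = gball E2 i u" using u by (intro agree_gball) auto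
    ultimately show ?thesis by (simp add: cap_def wsum_def)
  qed (use iff in \<open>simp add: cap_def\<close>)
qed

lemma cmatch_local:
  assumes k: "0 < k" and A: "\<And>z. agree E1 E2 \<omega>1 \<omega>2 k z \<Longrightarrow> z \<in> A1 \<longleftrightarrow> z \<in> A2"
    and m: "\<And>z. agree E1 E2 \<omega>1 \<omega>2 k z \<Longrightarrow> m1 z = m2 z"
    and w: "agree E1 E2 \<omega>1 \<omega>2 (2 * i + k) w"
  shows "cmatch K Q E1 A1 i m1 w = cmatch K Q E2 A2 i m2 w"
  unfolding cmatch_def
  using cluster_local[OF k A agree_mono[OF w, of "i + k"]] cap_local[OF k m w] by simp

text \<open>One step costs \<open>3 * i\<close>: from \<open>z\<close> to a centre \<open>w\<close>,
  from \<open>w\<close> to a member \<open>u\<close> of its ball, and from \<open>u\<close> to the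
  centres among which \<open>u\<close> splits its capacity.\<close>

lemma reweight_local:
  assumes k: "0 < k" and A: "\<And>z. agree E1 E2 \<omega>1 \<omega>2 k z \<Longrightarrow> z \<in> A1 \<longleftrightarrow> z \<in> A2"
    and m: "\<And>z. agree E1 E2 \<omega>1 \<omega>2 k z \<Longrightarrow> m1 z = m2 z"
    and z: "agree E1 E2 \<omega>1 \<omega>2 (3 * i + k) z"
  shows "reweight K Q E1 A1 i m1 z = reweight K Q E2 A2 i m2 z"
proof
  fix w
  have B: "gball E1 i z = gball E2 i z" using z by (intro agree_gball) auto
  have mz: "m1 z = m2 z" using m agree_mono[OF z] by simp
  show "reweight K Q E1 A1 i m1 z w = reweight K Q E2 A2 i m2 z w"
  proof (cases "w \<in> gball E1 i z")
    case True
    have w: "agree E1 E2 \<omega>1 \<omega>2 (2 * i + k) w"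
      using agree_sub[of E1 E2 \<omega>1 \<omega>2 i "2 * i + k" z, OF _ True] z by (simp add: numeral_3_eq_3)
    then have ik: "agree E1 E2 \<omega>1 \<omega>2 (i + k) w" by (rule agree_mono) simp
    have "cluster E1 A1 i w = cluster E2 A2 i w" by (rule cluster_local[OF k A ik])
    then show ?thesis
      using True B mz cap_local[OF k m w, where K = K and Q = Q] cmatch_local[OF k A m w, where K = K and Q = Q]
      by (simp add: reweight_def cload_def)
  qed (use B mz in \<open>simp add: reweight_def\<close>)
qed

lemma tokens_local:
  assumes k: "0 < k" and A: "\<And>z. agree E1 E2 \<omega>1 \<omega>2 k z \<Longrightarrow> z \<in> A1 \<longleftrightarrow> z \<in> A2"
    and m: "\<And>z. agree E1 E2 \<omega>1 \<omega>2 k z \<Longrightarrow> m1 z = m2 z"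
    and z: "agree E1 E2 \<omega>1 \<omega>2 (3 * i + k) z"
  shows "tokens K Q E1 A1 i m1 z = tokens K Q E2 A2 i m2 z"
proof
  fix u
  have B: "gball E1 i z = gball E2 i z" using z by (intro agree_gball) auto
  have *: "cluster E1 A1 i w = cluster E2 A2 i w \<and> cmatch K Q E1 A1 i m1 w = cmatch K Q E2 A2 i m2 w"
    if "w \<in> gball E1 i z" for w
  proof -
    have w: "agree E1 E2 \<omega>1 \<omega>2 (2 * i + k) w"
      using agree_sub[of E1 E2 \<omega>1 \<omega>2 i "2 * i + k" z, OF _ that] z by (simp add: numeral_3_eq_3)
    then have "agree E1 E2 \<omega>1 \<omega>2 (i + k) w" by (rule agree_mono) simp
    then show ?thesis using cluster_local[OF k A] cmatch_local[OF k A m w] by simp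
  qed
  show "tokens K Q E1 A1 i m1 z u = tokens K Q E2 A2 i m2 z u"
    unfolding tokens_def using B * by (intro sum.cong) auto
qed

lemma weights_local:
  assumes k: "0 < k"
    and \<sigma>: "\<And>z. agree E1 E2 \<omega>1 \<omega>2 k z \<Longrightarrow> fst \<sigma>1 z = fst \<sigma>2 z \<and> (\<forall>i. snd \<sigma>1 i z = snd \<sigma>2 i z)"
    and z: "agree E1 E2 \<omega>1 \<omega>2 (3 * i * s + k) z"
  shows "weights K Q E1 \<sigma>1 i s z = weights K Q E2 \<sigma>2 i s z"
  using z
proof (induction s arbitrary: z)
  case 0
  then show ?case using \<sigma> by (simp add: weights_def)
next
  case (Suc s)
  let ?A1 = "unmatched (fst \<sigma>1)" and ?A2 = "unmatched (fst \<sigma>2)"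
  have "z \<in> ?A1 \<longleftrightarrow> z \<in> ?A2" if "agree E1 E2 \<omega>1 \<omega>2 (3 * i * s + k) z" for z
    using \<sigma> agree_mono[OF that, of k] by (simp add: unmatched_def)
  then show ?case unfolding weights_def funpow.simps comp_def
    using reweight_local[of "3 * i * s + k" \<omega>1 \<omega>2 ?A1 ?A2
      "(reweight K Q E1 ?A1 i ^^ s) (snd \<sigma>1 i)" "(reweight K Q E2 ?A2 i ^^ s) (snd \<sigma>2 i)" i z K Q]
      Suc k by (simp add: weights_def algebra_simps)
qed

text \<open>Step \<open>s\<close> of radius \<open>i\<close> needs distance
  \<open>3 * i * (s + 1)\<close>, and \<open>R div i\<close> steps keep this below
  \<open>3 * R\<close> for all radii at once.\<close>

lemma slot_time:
  assumes "s < R div i"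
  shows "3 * i * s + 3 * i \<le> 3 * (R::nat)"
proof -
  have "i * Suc s \<le> i * (R div i)" using assms by (intro mult_le_mono) auto
  also have "\<dots> \<le> R" by simp
  finally show ?thesis by simp
qed

lemma proposal_local:
  assumes k: "0 < k"
    and \<sigma>: "\<And>z. agree E1 E2 \<omega>1 \<omega>2 k z \<Longrightarrow> fst \<sigma>1 z = fst \<sigma>2 z \<and> (\<forall>i. snd \<sigma>1 i z = snd \<sigma>2 i z)"
    and z: "agree E1 E2 \<omega>1 \<omega>2 (3 * R + k) z"
  shows "proposal K Q R E1 \<sigma>1 x z = proposal K Q R E2 \<sigma>2 x z"
proof -
  obtain i s where sl: "slot x = (i, s)" by force
  show ?thesis
  proof (cases "accepts x \<or> s \<ge> R div i")
    case False
    have "tokens K Q E1 (unmatched (fst \<sigma>1)) i (weights K Q E1 \<sigma>1 i s) z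
        = tokens K Q E2 (unmatched (fst \<sigma>2)) i (weights K Q E2 \<sigma>2 i s) z"
    proof (rule tokens_local[of "3 * i * s + k" \<omega>1 \<omega>2])
      show "0 < 3 * i * s + k" using k by simp
      show "agree E1 E2 \<omega>1 \<omega>2 (3 * i * s + k) x \<Longrightarrow>
        (x \<in> unmatched (fst \<sigma>1)) = (x \<in> unmatched (fst \<sigma>2))" for x
        using \<sigma>[of x] agree_mono[of E1 E2 \<omega>1 \<omega>2 "3 * i * s + k" x k] by (simp add: unmatched_def)
      show "agree E1 E2 \<omega>1 \<omega>2 (3 * i * s + k) x \<Longrightarrow> weights K Q E1 \<sigma>1 i s x = weights K Q E2 \<sigma>2 i s x" for x
        by (rule weights_local[OF k \<sigma>])
      show "agree E1 E2 \<omega>1 \<omega>2 (3 * i + (3 * i * s + k)) z"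
        using z by (rule agree_mono) (use slot_time[of s R i] False in simp)
    qed
    then show ?thesis using sl by (simp add: proposal_def)
  qed (use sl in \<open>simp add: proposal_def\<close>)
qed

lemma proposers_local:
  assumes k: "0 < k" and d: "\<And>x. \<omega>1 x = \<omega>2 x \<Longrightarrow> d1 x = d2 x"
    and \<sigma>: "\<And>z. agree E1 E2 \<omega>1 \<omega>2 k z \<Longrightarrow> fst \<sigma>1 z = fst \<sigma>2 z \<and> (\<forall>i. snd \<sigma>1 i z = snd \<sigma>2 i z)"
    and z: "agree E1 E2 \<omega>1 \<omega>2 (3 * R + k + 1) z"
  shows "proposers K Q R E1 \<sigma>1 d1 z = proposers K Q R E2 \<sigma>2 d2 z"
proof -
  have e: "{x, z} \<in> E1 \<longleftrightarrow> {x, z} \<in> E2" for x using agree_edge[OF z] by auto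
  have dz: "d1 z = d2 z" using z d unfolding agree_def by auto
  have "x \<in> proposers K Q R E1 \<sigma>1 d1 z \<longleftrightarrow> x \<in> proposers K Q R E2 \<sigma>2 d2 z" if "{x, z} \<in> E1" for x
  proof -
    have "x \<in> gball E1 1 z" using that hop_within_edge[of z x E1] by (simp add: gball_def insert_commute)
    then have x: "agree E1 E2 \<omega>1 \<omega>2 (3 * R + k) x" using agree_sub[of E1 E2 \<omega>1 \<omega>2 1 "3 * R + k" z x] z by simp
    have "d1 x = d2 x" using x d unfolding agree_def by auto
    moreover have "fst \<sigma>1 x = fst \<sigma>2 x" using \<sigma> agree_mono[OF x, of k] by simp
    ultimately show ?thesis using e[of x] dz proposal_local[OF k \<sigma> x] by (simp add: proposers_def unmatched_def)
  qed
  then show ?thesis using e by (auto simp: proposers_def)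
qed

text \<open>Of the two extra rounds, one collects the proposals of the neighbours and the other
  tells a proposer what its target received.\<close>

lemma phase_local:
  assumes k: "0 < k" and d: "\<And>x. \<omega>1 x = \<omega>2 x \<Longrightarrow> d1 x = d2 x"
    and \<sigma>: "\<And>z. agree E1 E2 \<omega>1 \<omega>2 k z \<Longrightarrow> fst \<sigma>1 z = fst \<sigma>2 z \<and> (\<forall>i. snd \<sigma>1 i z = snd \<sigma>2 i z)"
    and z: "agree E1 E2 \<omega>1 \<omega>2 (3 * R + 2 + k) z"
  shows "fst (phase K Q R E1 d1 \<sigma>1) z = fst (phase K Q R E2 d2 \<sigma>2) z \<and>
         (\<forall>i. snd (phase K Q R E1 d1 \<sigma>1) i z = snd (phase K Q R E2 d2 \<sigma>2) i z)"
proof (intro conjI allI)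
  have ag: "agree E1 E2 \<omega>1 \<omega>2 j z" if "j \<le> 3 * R + 2 + k" for j using agree_mono[OF z that] .
  show "snd (phase K Q R E1 d1 \<sigma>1) i z = snd (phase K Q R E2 d2 \<sigma>2) i z" for i
  proof -
    have "i * (R div i) \<le> R" by simp
    then have "3 * i * (R div i) + k \<le> 3 * R + 2 + k" by (simp only: mult.assoc)
    from weights_local[OF k \<sigma> ag[OF this]] show ?thesis by (simp add: phase_def)
  qed
  have dz: "d1 z = d2 z" using z d unfolding agree_def by auto
  have sz: "fst \<sigma>1 z = fst \<sigma>2 z" using \<sigma> ag by simp
  have pz: "proposers K Q R E1 \<sigma>1 d1 z = proposers K Q R E2 \<sigma>2 d2 z"
    by (rule proposers_local[OF k d \<sigma> ag]) auto
  have qz: "proposal K Q R E1 \<sigma>1 (d2 z) z = proposal K Q R E2 \<sigma>2 (d2 z) z"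
    by (rule proposal_local[OF k \<sigma> ag]) auto
  have iff: "(a \<in> unmatched (fst \<sigma>1) \<and> accepts (d1 a) \<and> z \<in> proposers K Q R E1 \<sigma>1 d1 a
        \<and> z = Min (proposers K Q R E1 \<sigma>1 d1 a)) \<longleftrightarrow>
      (a \<in> unmatched (fst \<sigma>2) \<and> accepts (d2 a) \<and> z \<in> proposers K Q R E2 \<sigma>2 d2 a
        \<and> z = Min (proposers K Q R E2 \<sigma>2 d2 a))" for a
  proof (cases "{z, a} \<in> E1")
    case True
    then have "a \<in> gball E1 1 z" using hop_within_edge[of z a E1] by (simp add: gball_def)
    then have a: "agree E1 E2 \<omega>1 \<omega>2 (3 * R + k + 1) a"
      using agree_sub[of E1 E2 \<omega>1 \<omega>2 1 "3 * R + k + 1" z a] z by simp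
    have "d1 a = d2 a" using a d unfolding agree_def by auto
    moreover have "fst \<sigma>1 a = fst \<sigma>2 a" using \<sigma> agree_mono[OF a, of k] by simp
    ultimately show ?thesis using proposers_local[OF k d \<sigma> a] by (simp add: unmatched_def)
  next
    case False
    moreover have "{z, a} \<notin> E2" using False agree_edge[OF z, of "{z, a}"] by auto
    ultimately show ?thesis by (simp add: proposers_def)
  qed
  show "fst (phase K Q R E1 d1 \<sigma>1) z = fst (phase K Q R E2 d2 \<sigma>2) z"
    unfolding phase_def fst_conv partner_def sz dz pz qz iff ..
qed

text \<open>Agreement refers to the original inputs \<open>W1\<close>, \<open>W2\<close>, which stay
  fixed in the induction while \<open>\<omega>1\<close>, \<open>\<omega>2\<close> lose their
  heads.\<close>

lemma run_local:
  assumes "0 < k" and "\<And>x. W1 x = W2 x \<Longrightarrow> \<omega>1 x = \<omega>2 x"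
    and "\<And>z. agree E1 E2 W1 W2 k z \<Longrightarrow> fst \<sigma>1 z = fst \<sigma>2 z \<and> (\<forall>i. snd \<sigma>1 i z = snd \<sigma>2 i z)"
    and "agree E1 E2 W1 W2 (b * (3 * R + 2) + k) z"
  shows "fst (run K Q R E1 b \<omega>1 \<sigma>1) z = fst (run K Q R E2 b \<omega>2 \<sigma>2) z"
  using assms
proof (induction b arbitrary: \<omega>1 \<omega>2 \<sigma>1 \<sigma>2 k z)
  case 0
  then show ?case by simp
next
  case (Suc b)
  show ?case unfolding run.simps
  proof (rule Suc.IH[of "3 * R + 2 + k"])
    show "0 < 3 * R + 2 + k" by simp
    show "W1 x = W2 x \<Longrightarrow> tl (\<omega>1 x) = tl (\<omega>2 x)" for x using Suc.prems(2) by simp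
    show "agree E1 E2 W1 W2 (3 * R + 2 + k) x \<Longrightarrow>
       fst (phase K Q R E1 (\<lambda>u. hd (\<omega>1 u)) \<sigma>1) x = fst (phase K Q R E2 (\<lambda>u. hd (\<omega>2 u)) \<sigma>2) x \<and>
       (\<forall>i. snd (phase K Q R E1 (\<lambda>u. hd (\<omega>1 u)) \<sigma>1) i x = snd (phase K Q R E2 (\<lambda>u. hd (\<omega>2 u)) \<sigma>2) i x)" for x
      by (rule phase_local[OF Suc.prems(1) _ Suc.prems(3)]) (use Suc.prems(2) in auto)
    show "agree E1 E2 W1 W2 (b * (3 * R + 2) + (3 * R + 2 + k)) z"
      using Suc.prems(4) by (simp add: algebra_simps)
  qed
qed

end

section \<open>Survival probability of an edge in one phase\<close>

text \<open>For independent events of total probability \<open>s \<le> 1\<close>, the chance that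
  some event occurs is at least \<open>s / 2\<close>: the product is at most
  \<open>exp (- s)\<close>, hence at most \<open>1 / (1 + s)\<close>.\<close>

lemma prod_one_minus_le:
  fixes a :: "'a \<Rightarrow> real"
  assumes "finite S" "\<And>x. x \<in> S \<Longrightarrow> 0 \<le> a x \<and> a x \<le> 1" "(\<Sum>x\<in>S. a x) \<le> 1"
  shows "(\<Prod>x\<in>S. 1 - a x) \<le> 1 - (\<Sum>x\<in>S. a x) / 2"
proof -
  let ?s = "\<Sum>x\<in>S. a x"
  have s: "0 \<le> ?s" using assms(2) by (intro sum_nonneg) auto
  have "(\<Prod>x\<in>S. 1 - a x) \<le> (\<Prod>x\<in>S. exp (- a x))"
    using assms(2) exp_ge_add_one_self[of "- a _"] by (intro prod_mono) auto
  also have "\<dots> = inverse (exp ?s)" using exp_sum[OF assms(1), of "\<lambda>x. - a x"] by (simp add: sum_negf exp_minus)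
  also have "\<dots> \<le> inverse (1 + ?s)" using s exp_ge_add_one_self[of ?s] by (intro le_imp_inverse_le) auto
  also have "\<dots> \<le> 1 - ?s / 2"
  proof -
    have "?s * ?s \<le> ?s" using s assms(3) mult_left_mono[of ?s 1 ?s] by simp
    then have "1 \<le> (1 - ?s / 2) * (1 + ?s)" by (simp add: algebra_simps)
    then show ?thesis using s by (simp add: divide_simps)
  qed
  finally show ?thesis .
qed

lemma draws_finite: "finite (draws R Q)"
  by (simp add: draws_def)

lemma card_draws: "card (draws R Q) = 2 * R ^ 2 * Q"
  by (simp add: draws_def card_cartesian_product power2_eq_square)

lemma draws_nonempty: "R > 0 \<Longrightarrow> Q > 0 \<Longrightarrow> draws R Q \<noteq> {}"
  using card_draws[of R Q] by (metis card.empty less_numeral_extra(3) mult_eq_0_iff power_not_zero zero_neq_numeral)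

text \<open>In step \<open>s\<close>, \<open>u\<close> accepts with probability
  \<open>1 / (2 * R ^ 2)\<close>. Independently, the other vertices propose to it with probabilities
  adding up to \<open>Y s / (2 * R ^ 2 * Q)\<close>, so some proposal arrives with at least half
  that probability. The product of the two is \<open>Y s / (8 * R ^ 4 * Q)\<close>.\<close>

lemma prob_matched_ge:
  fixes \<sigma> :: state and dflt :: draw
  assumes G: "simple_graph V E" and K: "K > 0" and Q: "Q > 0" and i: "i \<in> {1..R}"
    and u: "u \<in> V" "fst \<sigma> u = None"
  defines "M \<equiv> Pi_pmf V dflt (\<lambda>_. pmf_of_set (draws R Q))"
  shows "measure_pmf.prob M {d. partner K Q R E \<sigma> d u = None} \<le>
     1 - (\<Sum>s<R div i. real (vload K Q E (unmatched (fst \<sigma>)) i (weights K Q E \<sigma> i s) u)) / (8 * real R ^ 4 * real Q)"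
proof -
  let ?D = "draws R Q" and ?p = "pmf_of_set (draws R Q)"
  let ?A = "unmatched (fst \<sigma>)"
  define tok where "tok s z = tokens K Q E ?A i (weights K Q E \<sigma> i s) z u" for s z
  define Y where "Y s = real (vload K Q E ?A i (weights K Q E \<sigma> i s) u)" for s
  define Acc where "Acc s = {x\<in>?D. slot x = (i, s) \<and> accepts x}" for s
  define T where "T s z = {x\<in>?D. slot x = (i, s) \<and> proposal K Q R E \<sigma> x z = Some u}" for s z
  define Ev where "Ev s = {d. d u \<in> Acc s \<and> (\<exists>z\<in>V - {u}. d z \<in> T s z)}" for s
  have R: "R > 0" using i by auto
  have fin: "finite V" "finite ?D" "?D \<noteq> {}"
    using G draws_finite draws_nonempty[OF R Q] by (auto simp: simple_graph_def)
  have sR: "s < R" if "s < R div i" for s using that div_le_dividend[of R i] by linarith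
  have cardD: "real (card ?D) = 2 * real R ^ 2 * real Q" by (simp add: card_draws)
  have pr: "measure_pmf.prob ?p S = real (card S) / (2 * real R ^ 2 * real Q)" if "S \<subseteq> ?D" for S
    using fin that cardD by (simp add: measure_pmf_of_set Int_absorb1)
  have cAcc: "card (Acc s) = Q" if "s < R" for s
  proof -
    have "Acc s = (\<lambda>t. (i, s, True, t)) ` {..<Q}" using that i by (auto simp: Acc_def draws_def)
    then show ?thesis by (simp add: card_image inj_on_def)
  qed
  have cT: "card (T s z) = tok s z" if s: "s < R div i" for s z
  proof -
    have "T s z = (\<lambda>t. (i, s, False, t)) ` {t. t < Q \<and>
       token_target Q (tokens K Q E ?A i (weights K Q E \<sigma> i s) z) t = Some u}"
      using s sR[OF s] i by (auto simp: T_def draws_def proposal_def split: if_splits)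
    then show ?thesis
      using card_token_target[OF G K, of Q ?A i "weights K Q E \<sigma> i s" z u]
      by (simp add: card_image inj_on_def tok_def)
  qed
  have tokz: "{z, u} \<in> E \<and> z \<in> ?A" if "s < R div i" "x \<in> T s z" for s z x
  proof -
    have "finite (T s z)" using fin by (simp add: T_def)
    then have "tok s z \<noteq> 0" using cT[OF that(1), of z] that(2) card_gt_0_iff[of "T s z"] by auto
    then show ?thesis using tokens_pos_edge unfolding tok_def by blast
  qed
  have sub: "Ev s \<subseteq> {d. partner K Q R E \<sigma> d u \<noteq> None}" if s: "s < R div i" for s
  proof
    fix d assume "d \<in> Ev s"
    then obtain z where d: "d u \<in> Acc s" and z: "d z \<in> T s z" by (auto simp: Ev_def)
    then have "z \<in> proposers K Q R E \<sigma> d u"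
      using tokz[OF s z] by (auto simp: proposers_def Acc_def T_def)
    then have "partner K Q R E \<sigma> d u \<noteq> None"
      using d u by (auto simp: partner_def Acc_def)
    then show "d \<in> {d. partner K Q R E \<sigma> d u \<noteq> None}" by simp
  qed
  \<comment> \<open>The draw of \<open>u\<close> names a single step, so the success probabilities
    of different steps add up.\<close>
  have disj: "disjoint_family_on Ev {..<R div i}"
    by (auto simp: disjoint_family_on_def Ev_def Acc_def)
  have sumtok: "(\<Sum>z\<in>V - {u}. real (tok s z)) = Y s" for s
  proof -
    have "{u, u} \<notin> E" using G by (force simp: simple_graph_def)
    then have "tok s u = 0" unfolding tok_def using tokens_pos_edge(1) by blast
    then have "(\<Sum>z\<in>V - {u}. tok s z) = (\<Sum>z\<in>V. tok s z)" using fin u by (simp add: sum.remove)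
    also have "\<dots> = vload K Q E ?A i (weights K Q E \<sigma> i s) u"
      unfolding tok_def sum_tokens[OF G, symmetric] by (intro sum.cong) (auto intro: tokens_sym)
    finally show ?thesis unfolding Y_def by (simp flip: of_nat_sum)
  qed
  have prob_Ev: "measure_pmf.prob M (Ev s) \<ge> Y s / (8 * real R ^ 4 * real Q)" if s: "s < R div i" for s
  proof -
    \<comment> \<open>\<open>Pi V B\<close> is the event that \<open>u\<close> accepts but nobody
      proposes to it. Being a product set it has a product probability, and \<open>Ev s\<close> is
      its complement within acceptance.\<close>
    define B where "B z = (if z = u then Acc s else - T s z)" for z
    define c where "c = 2 * real R ^ 2 * real Q"
    have c: "c > 0" using R Q by (simp add: c_def)
    have YQ: "Y s \<le> real Q" using vload_le[OF G K] by (simp add: Y_def)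
    have Y0: "0 \<le> Y s" by (simp add: Y_def)
    have R1: "real R ^ 2 \<ge> 1" using R by simp
    have Yc: "Y s / c \<le> 1"
    proof -
      have "real Q * 1 \<le> real Q * (2 * real R ^ 2)" using R1 by (intro mult_left_mono) auto
      then have "Y s \<le> c" using YQ by (simp add: c_def mult.commute)
      then show ?thesis using c by simp
    qed
    have pAcc: "measure_pmf.prob ?p (Acc s) = 1 / (2 * real R ^ 2)"
      using pr[of "Acc s"] cAcc[OF sR[OF s]] Q by (simp add: Acc_def)
    have pT: "measure_pmf.prob ?p (T s z) = real (tok s z) / c" for z
      using pr[of "T s z"] cT[OF s, of z] by (simp add: T_def c_def)
    have full: "measure_pmf.prob M (Pi V (\<lambda>z. if z = u then Acc s else UNIV)) = 1 / (2 * real R ^ 2)"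
    proof -
      have "measure_pmf.prob M (Pi V (\<lambda>z. if z = u then Acc s else UNIV))
        = (\<Prod>z\<in>V. measure_pmf.prob ?p (if z = u then Acc s else UNIV))"
        unfolding M_def by (rule measure_Pi_pmf_Pi[OF fin(1)])
      also have "\<dots> = (\<Prod>z\<in>V. if z = u then 1 / (2 * real R ^ 2) else 1)"
        using pAcc by (intro prod.cong) auto
      also have "\<dots> = 1 / (2 * real R ^ 2)" using fin u by (simp add: prod.delta)
      finally show ?thesis .
    qed
    have part: "measure_pmf.prob M (Pi V B) \<le> (1 - Y s / c / 2) / (2 * real R ^ 2)"
    proof -
      have "(\<Prod>z\<in>V - {u}. measure_pmf.prob ?p (B z)) = (\<Prod>z\<in>V - {u}. 1 - real (tok s z) / c)"
        using pT measure_pmf.prob_compl[of _ ?p]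
        by (intro prod.cong) (auto simp: B_def Compl_eq_Diff_UNIV)
      also have "\<dots> \<le> 1 - (\<Sum>z\<in>V - {u}. real (tok s z) / c) / 2"
      proof (rule prod_one_minus_le)
        show "finite (V - {u})" using fin by simp
        show "0 \<le> real (tok s z) / c \<and> real (tok s z) / c \<le> 1" for z
          using pT[of z, symmetric] by simp
        show "(\<Sum>z\<in>V - {u}. real (tok s z) / c) \<le> 1"
          using Yc sumtok[of s] by (simp flip: sum_divide_distrib)
      qed
      also have "(\<Sum>z\<in>V - {u}. real (tok s z) / c) = Y s / c"
        using sumtok[of s] by (simp flip: sum_divide_distrib)
      finally have le: "(\<Prod>z\<in>V - {u}. measure_pmf.prob ?p (B z)) \<le> 1 - Y s / c / 2" .
      have "measure_pmf.prob M (Pi V B) = (\<Prod>z\<in>V. measure_pmf.prob ?p (B z))"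
        unfolding M_def by (rule measure_Pi_pmf_Pi[OF fin(1)])
      also have "\<dots> = measure_pmf.prob ?p (B u) * (\<Prod>z\<in>V - {u}. measure_pmf.prob ?p (B z))"
        by (rule prod.remove) (use fin u in auto)
      also have "\<dots> \<le> 1 / (2 * real R ^ 2) * (1 - Y s / c / 2)"
        using le pAcc by (simp only: B_def if_True refl) (intro mult_left_mono, auto)
      finally show ?thesis by simp
    qed
    have "Ev s = Pi V (\<lambda>z. if z = u then Acc s else UNIV) - Pi V B"
      using u by (auto simp: Ev_def B_def Pi_def split: if_splits)
    moreover have "Pi V B \<subseteq> Pi V (\<lambda>z. if z = u then Acc s else UNIV)"
      by (auto simp: B_def Pi_def)
    ultimately have "measure_pmf.prob M (Ev s) = 1 / (2 * real R ^ 2) - measure_pmf.prob M (Pi V B)"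
      using full by (simp add: measure_pmf.finite_measure_Diff)
    also have "\<dots> \<ge> 1 / (2 * real R ^ 2) - (1 - Y s / c / 2) / (2 * real R ^ 2)"
      using part by simp
    also have "1 / (2 * real R ^ 2) - (1 - Y s / c / 2) / (2 * real R ^ 2) = Y s / (8 * real R ^ 4 * real Q)"
      using R Q by (simp add: c_def diff_divide_distrib power4_eq_xxxx power2_eq_square)
    finally show ?thesis .
  qed
  have "(\<Sum>s<R div i. Y s) / (8 * real R ^ 4 * real Q) \<le> (\<Sum>s<R div i. measure_pmf.prob M (Ev s))"
    unfolding sum_divide_distrib by (intro sum_mono prob_Ev) auto
  also have "\<dots> = measure_pmf.prob M (\<Union>s<R div i. Ev s)"
    using disj by (intro measure_pmf.finite_measure_finite_Union[symmetric]) auto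
  also have "\<dots> \<le> measure_pmf.prob M {d. partner K Q R E \<sigma> d u \<noteq> None}"
    using sub by (intro measure_pmf.finite_measure_mono) auto
  also have "\<dots> = 1 - measure_pmf.prob M {d. partner K Q R E \<sigma> d u = None}"
    using measure_pmf.prob_compl[of "{d. partner K Q R E \<sigma> d u = None}" M] by (simp add: set_diff_eq)
  finally show ?thesis unfolding Y_def by simp
qed

section \<open>Survival probability of an edge over all phases\<close>

lemma weights_0: "weights K Q E \<sigma> i 0 = snd \<sigma> i"
  and weights_Suc: "weights K Q E \<sigma> i (Suc s) = reweight K Q E (unmatched (fst \<sigma>)) i (weights K Q E \<sigma> i s)"
  by (simp_all add: weights_def)

lemma ln_wsum_weights:
  assumes G: "simple_graph V E" and u: "u \<in> V" and K: "K > 0" and Q: "Q > 0"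
  shows "ln (real (wsum K E i (weights K Q E \<sigma> i S) u)) \<le> ln (real (wsum K E i (snd \<sigma> i) u))
     + real K / real Q * ((\<Sum>s<S. real (vload K Q E (unmatched (fst \<sigma>)) i (weights K Q E \<sigma> i s) u)) + real S * real (card V))"
proof (induction S)
  case (Suc S)
  have "ln (real (wsum K E i (weights K Q E \<sigma> i (Suc S)) u)) \<le> ln (real (wsum K E i (weights K Q E \<sigma> i S) u))
    + real K * (real (vload K Q E (unmatched (fst \<sigma>)) i (weights K Q E \<sigma> i S) u) + real (card V)) / real Q"
    unfolding weights_Suc by (rule ln_wsum_reweight[OF G u K Q])
  also note Suc.IH
  finally show ?case by (simp add: algebra_simps add_divide_distrib)
qed (simp add: weights_0)

text \<open>The unmatched set is frozen during a phase, so an edge alive at its start gains an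
  exponent in each of its steps, on every ball containing both ends.\<close>

lemma weights_edge:
  assumes G: "simple_graph V E" and e: "{u, v} \<in> E" "fst \<sigma> u = None" "fst \<sigma> v = None"
    and w: "w \<in> gball E i u \<inter> gball E i v"
  shows "snd \<sigma> i u w + snd \<sigma> i v w + S \<le> weights K Q E \<sigma> i S u w + weights K Q E \<sigma> i S v w"
proof (induction S)
  case (Suc S)
  have "weights K Q E \<sigma> i S u w + weights K Q E \<sigma> i S v w + 1
     \<le> weights K Q E \<sigma> i (Suc S) u w + weights K Q E \<sigma> i (Suc S) v w"
    unfolding weights_Suc by (rule reweight_edge[OF G e(1) _ _ w]) (use e in \<open>auto simp: unmatched_def\<close>)
  then show ?case using Suc.IH by linarith
qed (simp add: weights_0)

text \<open>Independent lists of draws can be sampled phase by phase, which allows conditioning on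
  the first phase in \<open>prob_run_Suc\<close>.\<close>

lemma Pi_replicate_pmf_Suc:
  assumes V: "finite V"
  shows "Pi_pmf V (replicate (Suc k) x) (\<lambda>_. replicate_pmf (Suc k) p) =
    bind_pmf (Pi_pmf V x (\<lambda>_. p)) (\<lambda>d. bind_pmf (Pi_pmf V (replicate k x) (\<lambda>_. replicate_pmf k p))
      (\<lambda>\<omega>. return_pmf (\<lambda>u. d u # \<omega> u)))"
proof -
  have "Pi_pmf V (replicate (Suc k) x) (\<lambda>_. replicate_pmf (Suc k) p) =
    bind_pmf (Pi_pmf V x (\<lambda>_. p)) (\<lambda>d. Pi_pmf V (replicate (Suc k) x)
        (\<lambda>u. bind_pmf (replicate_pmf k p) (\<lambda>xs. return_pmf (d u # xs))))"
    unfolding replicate_pmf.simps by (rule Pi_pmf_bind[OF V])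
  also have "\<dots> = bind_pmf (Pi_pmf V x (\<lambda>_. p)) (\<lambda>d. bind_pmf (Pi_pmf V (replicate k x) (\<lambda>_. replicate_pmf k p))
      (\<lambda>\<omega>. return_pmf (\<lambda>u. if u \<in> V then d u # \<omega> u else replicate (Suc k) x)))"
    by (subst Pi_pmf_bind[OF V, where d' = "replicate k x"]) (simp only: Pi_pmf_return_pmf[OF V])
  also have "\<dots> = bind_pmf (Pi_pmf V x (\<lambda>_. p)) (\<lambda>d. bind_pmf (Pi_pmf V (replicate k x) (\<lambda>_. replicate_pmf k p))
      (\<lambda>\<omega>. return_pmf (\<lambda>u. d u # \<omega> u)))"
  \<comment> \<open>Outside \<open>V\<close> both sides give the default value, as
    \<open>x # replicate k x\<close> is \<open>replicate (Suc k) x\<close>.\<close>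
  proof (intro bind_pmf_cong refl)
    fix d \<omega> assume "d \<in> set_pmf (Pi_pmf V x (\<lambda>_. p))"
      "\<omega> \<in> set_pmf (Pi_pmf V (replicate k x) (\<lambda>_. replicate_pmf k p))"
    then have "d u = x" "\<omega> u = replicate k x" if "u \<notin> V" for u
      using set_Pi_pmf_subset[OF V, of x "\<lambda>_. p"]
        set_Pi_pmf_subset[OF V, of "replicate k x" "\<lambda>_. replicate_pmf k p"] that by auto
    then have "(\<lambda>u. if u \<in> V then d u # \<omega> u else replicate (Suc k) x) = (\<lambda>u. d u # \<omega> u)"
      by (intro ext) simp
    then show "return_pmf (\<lambda>u. if u \<in> V then d u # \<omega> u else replicate (Suc k) x) = return_pmf (\<lambda>u. d u # \<omega> u)"
      by (rule arg_cong)
  qed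
  finally show ?thesis .
qed

lemma prob_run_Suc:
  fixes \<sigma> :: state
  assumes V: "finite V"
  shows "measure_pmf.prob (Pi_pmf V (replicate (Suc k) x) (\<lambda>_. replicate_pmf (Suc k) p)) {\<omega>. S (run K Q R E (Suc k) \<omega> \<sigma>)}
    = measure_pmf.expectation (Pi_pmf V x (\<lambda>_. p)) (\<lambda>d.
        measure_pmf.prob (Pi_pmf V (replicate k x) (\<lambda>_. replicate_pmf k p)) {\<omega>. S (run K Q R E k \<omega> (phase K Q R E d \<sigma>))})"
  (is "?l = measure_pmf.expectation ?M ?f")
proof -
  have "ennreal ?l = (\<integral>\<^sup>+d. ennreal (?f d) \<partial>?M)"
    unfolding Pi_replicate_pmf_Suc[OF V] measure_pmf.emeasure_eq_measure[symmetric]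
    by (simp add: map_pmf_def[symmetric] emeasure_bind_pmf measure_pmf.emeasure_eq_measure[symmetric] vimage_def)
  also have "\<dots> = ennreal (measure_pmf.expectation ?M ?f)"
    by (intro nn_integral_eq_integral measure_pmf.integrable_const_bound[where B = 1]) auto
  finally show ?thesis by (subst (asm) ennreal_inj) (auto intro: integral_nonneg_AE)
qed

text \<open>While the edge lives, \<open>wsum_prod_ge\<close> forces the sum of the two logarithmic
  weights up to \<open>2 ln |W| + (a + k * S) ln K\<close> in the end. A phase that raises this sum
  by \<open>y\<close> beyond the rounding loss is survived with probability at most
  \<open>exp (- \<theta> * y)\<close>, since the rise bounds the loads from below. These factors
  multiply and the rises telescope.\<close>

lemma survival_bound:
  fixes \<sigma> :: state and u v i R K Q :: nat and E :: "nat set set" and V :: "nat set"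
  assumes G: "simple_graph V E" and K: "K > 0" and Q: "Q > 0" and i: "i \<in> {1..R}"
    and uv: "{u, v} \<in> E"
  defines "W \<equiv> gball E i u \<inter> gball E i v"
  defines "\<theta> \<equiv> 1 / (16 * real R ^ 4 * real K)" and "S \<equiv> R div i"
  assumes a: "\<And>w. w \<in> W \<Longrightarrow> a \<le> snd \<sigma> i u w + snd \<sigma> i v w"
  shows "measure_pmf.prob (Pi_pmf V (replicate k x) (\<lambda>_. replicate_pmf k (pmf_of_set (draws R Q))))
      {\<omega>. fst (run K Q R E k \<omega> \<sigma>) u = None \<and> fst (run K Q R E k \<omega> \<sigma>) v = None}
    \<le> exp (- \<theta> * (2 * ln (real (card W)) + real (a + k * S) * ln (real K)
        - ln (real (wsum K E i (snd \<sigma> i) u)) - ln (real (wsum K E i (snd \<sigma> i) v))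
        - real (k * S) * (2 * real K * real (card V) / real Q)))"
  using a
proof (induction k arbitrary: \<sigma> a)
  case 0
  have fin: "finite W" using finite_gball[OF G] by (simp add: W_def)
  have "u \<in> gball E (Suc 0) v"
    using hop_within_edge[of v u E] uv by (simp add: gball_def insert_commute)
  then have "u \<in> W" using gball_mono[of "Suc 0" i E v] i by (auto simp: W_def)
  then have W: "card W > 0" using fin card_gt_0_iff by blast
  have pos: "wsum K E i (snd \<sigma> i) z > 0" for z by (rule wsum_pos[OF G K])
  \<comment> \<open>With no phase left, the lower bound on the weights makes the claimed bound at
    least 1.\<close>
  have "(real (card W))\<^sup>2 * real K ^ a \<le> real (wsum K E i (snd \<sigma> i) u) * real (wsum K E i (snd \<sigma> i) v)"
    by (rule wsum_prod_ge[OF G K]) (use 0 in \<open>auto simp: W_def\<close>)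
  then have "ln ((real (card W))\<^sup>2 * real K ^ a) \<le> ln (real (wsum K E i (snd \<sigma> i) u) * real (wsum K E i (snd \<sigma> i) v))"
    using W K by (intro ln_mono) auto
  then have "2 * ln (real (card W)) + real a * ln (real K)
      \<le> ln (real (wsum K E i (snd \<sigma> i) u)) + ln (real (wsum K E i (snd \<sigma> i) v))"
    using W K pos by (simp add: ln_mult ln_realpow)
  then have "0 \<le> - \<theta> * (2 * ln (real (card W)) + real (a + 0 * S) * ln (real K)
        - ln (real (wsum K E i (snd \<sigma> i) u)) - ln (real (wsum K E i (snd \<sigma> i) v))
        - real (0 * S) * (2 * real K * real (card V) / real Q))"
    by (simp add: \<theta>_def mult_nonneg_nonpos divide_nonpos_nonneg)
  then have "1 \<le> exp (- \<theta> * (2 * ln (real (card W)) + real (a + 0 * S) * ln (real K)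
        - ln (real (wsum K E i (snd \<sigma> i) u)) - ln (real (wsum K E i (snd \<sigma> i) v))
        - real (0 * S) * (2 * real K * real (card V) / real Q)))"
    by (subst one_le_exp_iff)
  then show ?case using measure_pmf.prob_le_1 order_trans by blast
next
  case (Suc k)
  let ?N = "\<lambda>k. Pi_pmf V (replicate k x) (\<lambda>_. replicate_pmf k (pmf_of_set (draws R Q)))"
  let ?alive = "\<lambda>\<sigma>::state. fst \<sigma> u = None \<and> fst \<sigma> v = None"
  let ?ph = "\<lambda>m. ln (real (wsum K E i m u)) + ln (real (wsum K E i m v))"
  define B where "B k a m = exp (- \<theta> * (2 * ln (real (card W)) + real (a + k * S) * ln (real K)
        - ln (real (wsum K E i m u)) - ln (real (wsum K E i m v))
        - real (k * S) * (2 * real K * real (card V) / real Q)))" for k a m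
  have V: "finite V" and uvV: "u \<in> V" "v \<in> V" using G uv by (auto simp: simple_graph_def)
  have goal: "measure_pmf.prob (?N (Suc k)) {\<omega>. ?alive (run K Q R E (Suc k) \<omega> \<sigma>)} \<le> B (Suc k) a (snd \<sigma> i)"
  proof (cases "?alive \<sigma>")
    case False
    then have "{\<omega>. ?alive (run K Q R E (Suc k) \<omega> \<sigma>)} = {}"
      using run_matched[of \<sigma> u] run_matched[of \<sigma> v] by blast
    then show ?thesis by (simp only: measure_empty B_def exp_ge_zero)
  next
    case True
    let ?M = "Pi_pmf V x (\<lambda>_. pmf_of_set (draws R Q))"
    let ?m = "weights K Q E \<sigma> i S"
    let ?Y = "\<lambda>u. \<Sum>s<S. real (vload K Q E (unmatched (fst \<sigma>)) i (weights K Q E \<sigma> i s) u)"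
    let ?c = "8 * real R ^ 4 * real Q"
    have c: "?c > 0" using i Q by auto
    \<comment> \<open>The weights after the phase depend on \<open>\<sigma>\<close> but not on the
      draw \<open>d\<close>, so the bound for the remaining phases is a constant factor of the
      expectation.\<close>
    have step: "measure_pmf.prob (?N k) {\<omega>. ?alive (run K Q R E k \<omega> (phase K Q R E d \<sigma>))}
       \<le> B k (a + S) ?m * indicator {d. partner K Q R E \<sigma> d u = None \<and> partner K Q R E \<sigma> d v = None} d" for d
    proof (cases "partner K Q R E \<sigma> d u = None \<and> partner K Q R E \<sigma> d v = None")
      case False
      then have "{\<omega>. ?alive (run K Q R E k \<omega> (phase K Q R E d \<sigma>))} = {}"
        using run_matched[of "phase K Q R E d \<sigma>" u] run_matched[of "phase K Q R E d \<sigma>" v]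
        by (auto simp: phase_def)
      then show ?thesis by (simp only: measure_empty) (simp add: B_def)
    next
      case d: True
      have snd: "snd (phase K Q R E d \<sigma>) i = ?m" by (simp add: phase_def S_def)
      have "measure_pmf.prob (?N k) {\<omega>. ?alive (run K Q R E k \<omega> (phase K Q R E d \<sigma>))} \<le> B k (a + S) ?m"
        unfolding B_def snd[symmetric]
      proof (rule Suc.IH)
        fix w assume w: "w \<in> W"
        have "a + S \<le> snd \<sigma> i u w + snd \<sigma> i v w + S" using Suc.prems[OF w] by simp
        also have "\<dots> \<le> ?m u w + ?m v w"
          by (rule weights_edge[OF G uv]) (use True w in \<open>auto simp: W_def\<close>)
        finally show "a + S \<le> snd (phase K Q R E d \<sigma>) i u w + snd (phase K Q R E d \<sigma>) i v w"
          by (simp add: snd)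
      qed
      then show ?thesis using d by simp
    qed
    have surv: "measure_pmf.prob ?M {d. partner K Q R E \<sigma> d u = None \<and> partner K Q R E \<sigma> d v = None}
       \<le> exp (- \<theta> * (?ph ?m - ?ph (snd \<sigma> i) - real S * (2 * real K * real (card V) / real Q)))"
    proof -
      let ?P = "measure_pmf.prob ?M {d. partner K Q R E \<sigma> d u = None \<and> partner K Q R E \<sigma> d v = None}"
      have "?P \<le> 1 - ?Y z / ?c" if z: "z \<in> {u, v}" for z
      proof -
        have zV: "z \<in> V" "fst \<sigma> z = None" using z uvV True by auto
        have "?P \<le> measure_pmf.prob ?M {d. partner K Q R E \<sigma> d z = None}"
          using z by (intro measure_pmf.finite_measure_mono) auto
        also note prob_matched_ge[OF G K Q i zV, of x]
        finally show ?thesis unfolding S_def .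
      qed
      \<comment> \<open>Survival of the edge implies survival of each end, so the two bounds can be
        averaged although the fates of the ends are dependent.\<close>
      from this[of u] this[of v] have "?P \<le> 1 - (?Y u + ?Y v) / (2 * ?c)"
        using c by (simp add: add_divide_distrib)
      also have "\<dots> \<le> exp (- ((?Y u + ?Y v) / (2 * ?c)))"
        using exp_ge_add_one_self[of "- ((?Y u + ?Y v) / (2 * ?c))"] by simp
      also have "\<dots> \<le> exp (- \<theta> * (?ph ?m - ?ph (snd \<sigma> i) - real S * (2 * real K * real (card V) / real Q)))"
      proof -
        have "?ph ?m - ?ph (snd \<sigma> i) - real S * (2 * real K * real (card V) / real Q) \<le> real K / real Q * (?Y u + ?Y v)"
        proof -
          have eq: "real S * (2 * real K * real (card V) / real Q) = 2 * (real K / real Q * (real S * real (card V)))"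
            by simp
          show ?thesis
            using ln_wsum_weights[OF G uvV(1) K Q, of i \<sigma> S] ln_wsum_weights[OF G uvV(2) K Q, of i \<sigma> S]
            unfolding eq distrib_left by linarith
        qed
        moreover have "0 \<le> \<theta>" by (simp add: \<theta>_def)
        ultimately have "\<theta> * (?ph ?m - ?ph (snd \<sigma> i) - real S * (2 * real K * real (card V) / real Q))
          \<le> \<theta> * (real K / real Q * (?Y u + ?Y v))" by (rule mult_left_mono)
        \<comment> \<open>\<open>\<theta>\<close> is chosen to give
          \<open>\<theta> * K / Q = 1 / (16 * R ^ 4 * Q)\<close>.\<close>
        also have "\<dots> = (?Y u + ?Y v) / (2 * ?c)" using K by (simp add: \<theta>_def)
        finally show ?thesis by simp
      qed
      finally show ?thesis .
    qed
    have "measure_pmf.prob (?N (Suc k)) {\<omega>. ?alive (run K Q R E (Suc k) \<omega> \<sigma>)}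
      = measure_pmf.expectation ?M (\<lambda>d. measure_pmf.prob (?N k) {\<omega>. ?alive (run K Q R E k \<omega> (phase K Q R E d \<sigma>))})"
      by (rule prob_run_Suc[OF V])
    also have "\<dots> \<le> measure_pmf.expectation ?M (\<lambda>d. B k (a + S) ?m *
        indicator {d. partner K Q R E \<sigma> d u = None \<and> partner K Q R E \<sigma> d v = None} d)"
    proof (rule integral_mono)
      show "integrable ?M (\<lambda>d. measure_pmf.prob (?N k) {\<omega>. ?alive (run K Q R E k \<omega> (phase K Q R E d \<sigma>))})"
        by (intro measure_pmf.integrable_const_bound[where B = 1]) simp_all
      show "integrable ?M (\<lambda>d. B k (a + S) ?m *
          indicator {d. partner K Q R E \<sigma> d u = None \<and> partner K Q R E \<sigma> d v = None} d)"
        by (intro integrable_mult_right integrable_real_indicator) (simp_all add: measure_pmf.emeasure_eq_measure)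
    qed (rule step)
    also have "\<dots> = B k (a + S) ?m *
        measure_pmf.prob ?M {d. partner K Q R E \<sigma> d u = None \<and> partner K Q R E \<sigma> d v = None}"
      by simp
    also have "\<dots> \<le> B k (a + S) ?m * exp (- \<theta> * (?ph ?m - ?ph (snd \<sigma> i) - real S * (2 * real K * real (card V) / real Q)))"
      using surv by (intro mult_left_mono) (auto simp: B_def)
    also have "\<dots> = B (Suc k) a (snd \<sigma> i)"
    proof -
      define err where "err = 2 * real K * real (card V) / real Q"
      show ?thesis
        unfolding B_def exp_add[symmetric] err_def[symmetric]
        by (rule arg_cong[of _ _ exp]) (simp add: algebra_simps)
    qed
    finally show ?thesis .
  qed
  then show ?case unfolding B_def .
qed

section \<open>Choosing a radius with little growth\<close>

text \<open>Otherwise the growths would exceed a multiple of \<open>1 / i\<close> for every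
  \<open>i\<close>; summed up, the harmonic sum is at least \<open>ln (R + 1)\<close> while the
  growths telescope to at most \<open>2 ln |V|\<close>.\<close>

lemma good_radius:
  assumes G: "simple_graph V E" and uv: "u \<in> V" "v \<in> V" and R: "R > 0"
  defines "f \<equiv> \<lambda>w i. ln (real (card (gball E i w)))"
  shows "\<exists>i\<in>{1..R}. f u i - f u (i - 1) + (f v i - f v (i - 1)) \<le> 2 * ln (real (card V)) / (real i * ln (real R + 1))"
proof (rule ccontr)
  assume "\<not> ?thesis"
  then have *: "2 * ln (real (card V)) / (real i * ln (real R + 1)) < f u i - f u (i - 1) + (f v i - f v (i - 1))"
    if "i \<in> {1..R}" for i using that by force
  have V: "finite V" using G by (auto simp: simple_graph_def)
  define c where "c = 2 * ln (real (card V)) / ln (real R + 1)"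
  have n: "card V \<ge> 1" using uv V by (metis One_nat_def Suc_leI card_gt_0_iff empty_iff)
  have lnR: "ln (real R + 1) > 0" using R by simp
  have c: "c \<ge> 0" using n lnR by (simp add: c_def)
  have bound: "f w R - f w 0 \<le> ln (real (card V))" if "w \<in> V" for w
  proof -
    have "card (gball E R w) \<le> card V" using gball_subset[OF G that] V by (intro card_mono)
    moreover have "card (gball E R w) > 0" using finite_gball[OF G] self_in_gball card_gt_0_iff by blast
    ultimately show ?thesis by (simp add: f_def gball_0)
  qed
  have tel: "(\<Sum>i=1..R. f w i - f w (i - 1)) = f w R - f w 0" for w
    by (induction R) (auto simp: sum.atLeast_Suc_atMost_Suc_shift)
  have "2 * ln (real (card V)) = c * ln (real R + 1)" using lnR by (simp add: c_def)
  also have "\<dots> \<le> c * harm R" using c ln_le_harm[of R] by (intro mult_left_mono) auto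
  also have "\<dots> = (\<Sum>i=1..R. c / real i)" by (simp add: harm_def sum_distrib_left divide_inverse)
  also have "\<dots> < (\<Sum>i=1..R. f u i - f u (i - 1) + (f v i - f v (i - 1)))"
    using * R by (intro sum_strict_mono) (auto simp: c_def mult.commute)
  also have "\<dots> = (f u R - f u 0) + (f v R - f v 0)" by (simp only: sum.distrib tel)
  also have "\<dots> \<le> 2 * ln (real (card V))" using bound[OF uv(1)] bound[OF uv(2)] by simp
  finally show False by simp
qed

text \<open>\<open>Qbig\<close> keeps the rounding loss below half of the gain \<open>ln K\<close>
  per step, and \<open>Bbig\<close> provides enough steps to outweigh the growth of the balls at the
  good radius.\<close>

lemma edge_survival:
  fixes K Q R B :: nat and V :: "nat set"
  assumes G: "simple_graph V E" and e: "{u, v} \<in> E" and K: "K > 1" and Q: "Q > 0" and R: "R > 0"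
    and Qbig: "2 * real K * real (card V) / real Q \<le> ln (real K) / 2"
    and Bbig: "16 * ln (real (card V)) / ln (real R + 1) \<le> real B * real R * ln (real K)"
  shows "measure_pmf.prob (Pi_pmf V (replicate B x) (\<lambda>_. replicate_pmf B (pmf_of_set (draws R Q))))
      {\<omega>. fst (run K Q R E B \<omega> initial) u = None \<and> fst (run K Q R E B \<omega> initial) v = None}
    \<le> exp (- (real B * ln (real K) / (128 * real R ^ 4 * real K)))"
proof -
  have uv: "u \<in> V" "v \<in> V" using G e by (auto simp: simple_graph_def)
  obtain i where i: "i \<in> {1..R}" and gr:
    "ln (real (card (gball E i u))) - ln (real (card (gball E (i - 1) u))) +
     (ln (real (card (gball E i v))) - ln (real (card (gball E (i - 1) v))))
      \<le> 2 * ln (real (card V)) / (real i * ln (real R + 1))"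
    using good_radius[OF G uv R] by blast
  define W where "W = gball E i u \<inter> gball E i v"
  define S where "S = R div i"
  define \<theta> where "\<theta> = 1 / (16 * real R ^ 4 * real K)"
  define err where "err = 2 * real K * real (card V) / real Q"
  define X where "X = real B * real S * ln (real K)"
  have K0: "K > 0" "ln (real K) > 0" using K by auto
  have fin: "finite (gball E j w)" for j w by (rule finite_gball[OF G])
  have pos: "card (gball E j w) > 0" for j w using fin self_in_gball card_gt_0_iff by blast
  \<comment> \<open>Hence \<open>2 ln |W|\<close> is at least the sum of the logarithms of the ball
    sizes at radius \<open>i - 1\<close>, and the initial deficit is at most the growth to radius
    \<open>i\<close>.\<close>
  have sub: "gball E (i - 1) u \<subseteq> W" "gball E (i - 1) v \<subseteq> W"
    using gball_mono[of "i - 1" i E] edge_gball[OF e, of "i - 1"] edge_gball[of v u E "i - 1"] e i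
    by (auto simp: W_def insert_commute)
  have W: "ln (real (card (gball E (i - 1) w))) \<le> ln (real (card W))" if "w \<in> {u, v}" for w
  proof -
    have "card (gball E (i - 1) w) \<le> card W" using that sub fin by (intro card_mono) (auto simp: W_def)
    then show ?thesis using pos[of "i - 1" w] by (intro ln_mono) auto
  qed
  have ws: "wsum K E i (snd initial i) w = card (gball E i w)" for w
    by (simp add: wsum_def initial_def)
  have "measure_pmf.prob (Pi_pmf V (replicate B x) (\<lambda>_. replicate_pmf B (pmf_of_set (draws R Q))))
      {\<omega>. fst (run K Q R E B \<omega> initial) u = None \<and> fst (run K Q R E B \<omega> initial) v = None}
    \<le> exp (- \<theta> * (2 * ln (real (card W)) + real (0 + B * S) * ln (real K)
        - ln (real (wsum K E i (snd initial i) u)) - ln (real (wsum K E i (snd initial i) v))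
        - real (B * S) * (2 * real K * real (card V) / real Q)))"
    unfolding W_def \<theta>_def S_def by (rule survival_bound[OF G K0(1) Q i e]) simp
  also have "\<dots> \<le> exp (- (real B * ln (real K) / (128 * real R ^ 4 * real K)))"
  proof -
    \<comment> \<open>Rounding \<open>R / i\<close> down at most halves it, as
      \<open>i \<le> R\<close>.\<close>
    have "real R \<le> 2 * (real i * real S)"
    proof -
      have "R = i * S + R mod i" "R mod i < i" "S \<ge> 1"
        using i by (auto simp: S_def Suc_le_eq div_greater_zero_iff)
      moreover from this have "i \<le> i * S" by simp
      ultimately have "R \<le> 2 * (i * S)" by linarith
      then show ?thesis unfolding of_nat_le_iff[where 'a = real, symmetric] by simp
    qed
    then have iS: "real R / (2 * real i) \<le> real S" using i by (simp add: field_simps)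
    have "real B * ln (real K) * (real R / (2 * real i)) \<le> real B * ln (real K) * real S"
      using iS K0 by (intro mult_left_mono) auto
    then have X1: "real B * real R * ln (real K) / (2 * real i) \<le> X"
      by (simp add: X_def mult_ac)
    have "2 * ln (real (card V)) / (real i * ln (real R + 1)) = (16 * ln (real (card V)) / ln (real R + 1)) / (8 * real i)"
      by simp
    also have "\<dots> \<le> real B * real R * ln (real K) / (8 * real i)" using Bbig by (intro divide_right_mono) auto
    also have "\<dots> \<le> X / 4" using X1 by simp
    finally have X2: "2 * ln (real (card V)) / (real i * ln (real R + 1)) \<le> X / 4" .
    have "real B * real S * err \<le> real B * real S * (ln (real K) / 2)"
      unfolding err_def using Qbig by (intro mult_left_mono) auto
    then have X3: "real B * real S * err \<le> X / 2" by (simp add: X_def)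
    have "1 \<le> S" using i by (auto simp: S_def Suc_le_eq div_greater_zero_iff)
    then have "real B * ln (real K) * 1 \<le> real B * ln (real K) * real S"
      using K0 by (intro mult_left_mono) auto
    then have X4: "real B * ln (real K) \<le> X" by (simp add: X_def mult_ac)
    have X0: "0 \<le> X" using K0 by (simp add: X_def)
    \<comment> \<open>Of the total gain \<open>X\<close>, growth takes at most a quarter and
      rounding at most half; the remaining quarter is at least \<open>B ln K / 4\<close>.\<close>
    have "real B * ln (real K) / 8 \<le> 2 * ln (real (card W)) + X - ln (real (card (gball E i u)))
        - ln (real (card (gball E i v))) - real B * real S * err"
      using W[of u] W[of v] gr X2 X3 X4 X0 by simp
    then have "\<theta> * (real B * ln (real K) / 8) \<le> \<theta> * (2 * ln (real (card W)) + X - ln (real (card (gball E i u)))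
        - ln (real (card (gball E i v))) - real B * real S * err)"
      by (intro mult_left_mono) (auto simp: \<theta>_def)
    moreover have "\<theta> * (real B * ln (real K) / 8) = real B * ln (real K) / (128 * real R ^ 4 * real K)"
      by (simp add: \<theta>_def)
    moreover have "real (0 + B * S) * ln (real K) = X" "real (B * S) * err = real B * real S * err"
      by (simp_all add: X_def)
    ultimately show ?thesis
      unfolding ws err_def[symmetric] by (simp only: exp_le_cancel_iff mult_minus_left neg_le_iff_le)
  qed
  finally show ?thesis .
qed

section \<open>From real-valued to finite random inputs\<close>

text \<open>Lists of draws are uniform, so a real input can be turned into one by cutting the unit
  interval into equal pieces.\<close>

lemma pmf_replicate_of_set:
  assumes D: "finite D" "D \<noteq> {}" and l: "length l = k" "set l \<subseteq> D"
  shows "pmf (replicate_pmf k (pmf_of_set D)) l = 1 / real (card D) ^ k"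
  using l
proof (induction k arbitrary: l)
  case (Suc k)
  then obtain y ys where l: "l = y # ys" "length ys = k" "set ys \<subseteq> D" "y \<in> D" by (cases l) auto
  have "replicate_pmf (Suc k) (pmf_of_set D)
     = map_pmf (\<lambda>(x, xs). x # xs) (pair_pmf (pmf_of_set D) (replicate_pmf k (pmf_of_set D)))"
    by (simp add: pair_pmf_def map_bind_pmf)
  moreover have "pmf (map_pmf (\<lambda>(x, xs). x # xs) (pair_pmf (pmf_of_set D) (replicate_pmf k (pmf_of_set D))))
      ((\<lambda>(x, xs). x # xs) (y, ys)) = pmf (pair_pmf (pmf_of_set D) (replicate_pmf k (pmf_of_set D))) (y, ys)"
    by (rule pmf_map_inj') (auto simp: inj_on_def)
  ultimately show ?case using l D Suc.IH[of ys] by (simp add: pmf_pair pmf_of_set)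
qed simp

lemma set_replicate_of_set:
  assumes "finite D" "D \<noteq> {}"
  shows "set_pmf (replicate_pmf k (pmf_of_set D)) = {l. set l \<subseteq> D \<and> length l = k}"
  using assms by (auto simp: set_replicate_pmf lists_eq_set)

text \<open>\<open>mod N\<close> keeps the index in range for every real \<open>x\<close>, including
  \<open>x = 1\<close> and points outside the unit interval.\<close>

definition tape :: "nat \<Rightarrow> (nat \<Rightarrow> 'a) \<Rightarrow> real \<Rightarrow> 'a" where
  "tape N \<beta> x = \<beta> (nat \<lfloor>x * real N\<rfloor> mod N)"

lemma measurable_tape: "tape N \<beta> \<in> borel \<rightarrow>\<^sub>M count_space UNIV"
proof -
  have "(\<lambda>x::real. \<lfloor>x * real N\<rfloor>) \<in> borel \<rightarrow>\<^sub>M count_space UNIV" by measurable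
  then show ?thesis unfolding tape_def by measurable
qed

lemma unit_prob_space: "prob_space (uniform_measure lborel {0..1::real})"
  by (rule prob_space_uniform_measure) auto

lemma measure_tape:
  assumes N: "N > 0" and \<beta>: "inj_on \<beta> {..<N}" and j: "j < N"
  shows "measure (uniform_measure lborel {0..1}) {x. tape N \<beta> x = \<beta> j} = 1 / real N"
proof -
  let ?A = "{x. tape N \<beta> x = \<beta> j}" and ?I = "{real j / real N..<real (Suc j) / real N}"
  have A: "?A \<in> sets borel" using measurable_sets[OF measurable_tape[of N \<beta>], of "{\<beta> j}"] by (simp add: vimage_def)
  have mem: "x \<in> ?A \<longleftrightarrow> nat \<lfloor>x * real N\<rfloor> mod N = j" for x
    using \<beta> j N by (auto simp: tape_def dest: inj_onD)
  have part: "x \<in> ?A \<longleftrightarrow> x \<in> ?I" if x: "0 \<le> x" "x < 1" for x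
  proof -
    have "x * real N < real N" using x N by simp
    then have "\<lfloor>x * real N\<rfloor> < int N" by (simp add: floor_less_iff)
    moreover have "0 \<le> \<lfloor>x * real N\<rfloor>" using x by simp
    moreover from calculation have "nat \<lfloor>x * real N\<rfloor> mod N = nat \<lfloor>x * real N\<rfloor>" by (intro mod_less) linarith
    ultimately have "x \<in> ?A \<longleftrightarrow> \<lfloor>x * real N\<rfloor> = int j" unfolding mem by (auto simp: nat_eq_iff)
    also have "\<dots> \<longleftrightarrow> real j \<le> x * real N \<and> x * real N < real j + 1" by (simp add: floor_eq_iff)
    also have "\<dots> \<longleftrightarrow> x \<in> ?I" using N by (simp add: field_simps)
    finally show ?thesis .
  qed
  have Isub: "?I \<subseteq> {0..<1}"
  proof
    fix x assume "x \<in> ?I"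
    moreover have "real (Suc j) / real N \<le> 1" using j by simp
    moreover have "0 \<le> real j / real N" by simp
    ultimately show "x \<in> {0..<1}" unfolding atLeastLessThan_iff by linarith
  qed
  have "emeasure lborel ({0..1} \<inter> ?A) = emeasure lborel ?I"
  proof (rule antisym)
    \<comment> \<open>The point 1 is wrapped around to the first interval; it is a null set.\<close>
    have "{0..1} \<inter> ?A \<subseteq> ?I \<union> {1}"
    proof
      fix x assume "x \<in> {0..1} \<inter> ?A"
      then show "x \<in> ?I \<union> {1}" using part[of x] by (cases "x < 1") auto
    qed
    then have "emeasure lborel ({0..1} \<inter> ?A) \<le> emeasure lborel (?I \<union> {1})"
      by (intro emeasure_mono) auto
    also have "\<dots> \<le> emeasure lborel ?I + emeasure lborel {1::real}"
      by (intro emeasure_subadditive) auto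
    finally show "emeasure lborel ({0..1} \<inter> ?A) \<le> emeasure lborel ?I" by simp
    show "emeasure lborel ?I \<le> emeasure lborel ({0..1} \<inter> ?A)"
    proof (rule emeasure_mono)
      show "?I \<subseteq> {0..1} \<inter> ?A"
      proof
        fix x assume x: "x \<in> ?I"
        then have "x \<in> {0..<1}" using Isub by blast
        then show "x \<in> {0..1} \<inter> ?A" using part[of x] x by auto
      qed
    qed (use A in auto)
  qed
  also have "\<dots> = ennreal (1 / real N)"
    using N by (simp add: divide_right_mono add_divide_distrib)
  finally have "emeasure lborel ({0..1} \<inter> ?A) = ennreal (1 / real N)" .
  then show ?thesis using A by (simp add: measure_def emeasure_uniform_measure divide_ennreal_def)
qed

text \<open>The inputs matter only through \<open>g\<close>, so the event is a finite disjoint union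
  of boxes, one for each admissible \<open>\<omega>\<close>. Both measures give a box the same
  product of probabilities.\<close>

lemma rand_space_transfer:
  fixes q :: "'b pmf" and g :: "real \<Rightarrow> 'b"
  assumes V: "finite V" and g: "g \<in> borel \<rightarrow>\<^sub>M count_space UNIV" and fin: "finite (set_pmf q)"
    and dist: "\<And>l. l \<in> set_pmf q \<Longrightarrow> measure (uniform_measure lborel {0..1}) {x. g x = l} = pmf q l"
    and range: "\<And>x. g x \<in> set_pmf q"
  shows "measure (rand_space V) {\<rho> \<in> space (rand_space V). P (\<lambda>u. if u \<in> V then g (\<rho> u) else d)}
     = measure_pmf.prob (Pi_pmf V d (\<lambda>_. q)) {\<omega>. P \<omega>}"
proof -
  let ?U = "\<lambda>_::nat. uniform_measure lborel {0..1::real}"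
  interpret U: finite_product_prob_space ?U V
    unfolding finite_product_prob_space_def finite_product_sigma_finite_def product_prob_space_def
      product_sigma_finite_def finite_product_sigma_finite_axioms_def product_prob_space_axioms_def
    using V unit_prob_space by (auto intro: prob_space_imp_sigma_finite)
  define S where "S = {\<omega> \<in> PiE_dflt V d (\<lambda>_. set_pmf q). P \<omega>}"
  define box where "box \<omega> = PiE V (\<lambda>u. {x. g x = \<omega> u})" for \<omega>
  have gs: "{x. g x = l} \<in> sets (uniform_measure lborel {0..1})" for l
    using measurable_sets[OF g, of "{l}"] by (simp add: vimage_def)
  have "finite (PiE_dflt V d (\<lambda>_. set_pmf q))" using V fin by (intro finite_PiE_dflt) auto
  then have finS: "finite S" by (rule rev_finite_subset) (auto simp: S_def)
  have sp: "space (rand_space V) = PiE V (\<lambda>_. UNIV)" by (simp add: rand_space_def space_PiM)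
  have ev: "{\<rho> \<in> space (rand_space V). P (\<lambda>u. if u \<in> V then g (\<rho> u) else d)} = (\<Union>\<omega>\<in>S. box \<omega>)"
  proof (intro set_eqI iffI)
    fix \<rho> assume r: "\<rho> \<in> {\<rho> \<in> space (rand_space V). P (\<lambda>u. if u \<in> V then g (\<rho> u) else d)}"
    let ?w = "\<lambda>u. if u \<in> V then g (\<rho> u) else d"
    have "?w \<in> S" using r range by (auto simp: S_def PiE_dflt_def)
    moreover have "\<rho> \<in> box ?w" using r by (auto simp: box_def sp PiE_def)
    ultimately show "\<rho> \<in> (\<Union>\<omega>\<in>S. box \<omega>)" by blast
  next
    fix \<rho> assume "\<rho> \<in> (\<Union>\<omega>\<in>S. box \<omega>)"
    then obtain \<omega> where w: "\<omega> \<in> S" "\<rho> \<in> box \<omega>" by blast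
    then have "(\<lambda>u. if u \<in> V then g (\<rho> u) else d) = \<omega>"
      by (auto simp: S_def box_def PiE_dflt_def PiE_def Pi_def fun_eq_iff)
    then show "\<rho> \<in> {\<rho> \<in> space (rand_space V). P (\<lambda>u. if u \<in> V then g (\<rho> u) else d)}"
      using w by (auto simp: S_def box_def sp PiE_def)
  qed
  have disj: "disjoint_family_on box S"
    unfolding disjoint_family_on_def
  proof (intro ballI impI)
    fix \<omega> \<omega>' assume w: "\<omega> \<in> S" "\<omega>' \<in> S" "\<omega> \<noteq> \<omega>'"
    then obtain u where "\<omega> u \<noteq> \<omega>' u" by auto
    moreover from this have "u \<in> V" using w by (auto simp: S_def PiE_dflt_def)
    ultimately show "box \<omega> \<inter> box \<omega>' = {}" by (auto simp: box_def PiE_def Pi_def)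
  qed
  have "measure (rand_space V) (\<Union>\<omega>\<in>S. box \<omega>) = (\<Sum>\<omega>\<in>S. measure (rand_space V) (box \<omega>))"
    unfolding rand_space_def
    by (rule U.P.finite_measure_finite_Union[OF finS _ disj]) (use V gs in \<open>auto simp: box_def intro!: sets_PiM_I_finite\<close>)
  also have "\<dots> = (\<Sum>\<omega>\<in>S. pmf (Pi_pmf V d (\<lambda>_. q)) \<omega>)"
  proof (rule sum.cong[OF refl])
    fix \<omega> assume w: "\<omega> \<in> S"
    have "measure (rand_space V) (box \<omega>) = (\<Prod>u\<in>V. measure (?U u) {x. g x = \<omega> u})"
      unfolding rand_space_def box_def by (rule U.prob_times) (rule gs)
    also have "\<dots> = (\<Prod>u\<in>V. pmf q (\<omega> u))"
      using w dist by (intro prod.cong) (auto simp: S_def PiE_dflt_def)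
    also have "\<dots> = pmf (Pi_pmf V d (\<lambda>_. q)) \<omega>"
      using w V by (subst pmf_Pi) (auto simp: S_def PiE_dflt_def)
    finally show "measure (rand_space V) (box \<omega>) = pmf (Pi_pmf V d (\<lambda>_. q)) \<omega>" .
  qed
  also have "\<dots> = measure_pmf.prob (Pi_pmf V d (\<lambda>_. q)) S"
    using finS by (simp add: measure_measure_pmf_finite)
  also have "\<dots> = measure_pmf.prob (Pi_pmf V d (\<lambda>_. q)) {\<omega>. P \<omega>}"
    by (rule measure_pmf.finite_measure_eq_AE) (use set_Pi_pmf[OF V, of d "\<lambda>_. q"] in \<open>auto simp: S_def intro!: AE_pmfI\<close>)
  finally show ?thesis unfolding ev .
qed

section \<open>Approximation ratio\<close>

lemma max_matching_attained:
  assumes "simple_graph V E"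
  obtains M where "is_matching E M" "card M = max_matching_size E"
proof -
  have "finite {M. is_matching E M}"
    by (rule finite_subset[of _ "Pow E"]) (auto simp: is_matching_def finite_edges[OF assms])
  moreover have "{} \<in> {M. is_matching E M}" by (simp add: is_matching_def)
  ultimately have "max_matching_size E \<in> card ` {M. is_matching E M}"
    unfolding max_matching_size_def by (intro Max_in) auto
  then show ?thesis using that by auto
qed

text \<open>Charge each edge of \<open>M\<close> with a matched end to one such end. The edges of
  \<open>M\<close> are disjoint, so the charges are distinct, and the output covers at most twice as
  many vertices as it has edges.\<close>

lemma card_matching_le:
  assumes G: "simple_graph V E" and P: "proper E P" and M: "is_matching E M"
  shows "card M \<le> 2 * card (output_matching V P) + card {e\<in>M. \<forall>x\<in>e. P x = None}"
proof -
  let ?O = "output_matching V P" and ?X = "{x\<in>V. P x \<noteq> None}"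
  let ?M1 = "{e\<in>M. \<exists>x\<in>e. P x \<noteq> None}"
  have fin: "finite V" "finite E" using G finite_edges by (auto simp: simple_graph_def)
  have OE: "?O \<subseteq> E" using P unfolding output_matching_def proper_def by blast
  then have finO: "finite ?O" using fin finite_subset by blast
  have ME: "M \<subseteq> E" using M by (auto simp: is_matching_def)
  then have finM: "finite M" using fin finite_subset by blast
  have "card ?X \<le> card (\<Union>?O)"
  proof (rule card_mono)
    have "\<Union>?O \<subseteq> V" using OE G unfolding simple_graph_def by blast
    then show "finite (\<Union>?O)" using fin finite_subset by blast
    show "?X \<subseteq> \<Union>?O" unfolding output_matching_def by blast
  qed
  also have "\<dots> \<le> (\<Sum>e\<in>?O. card e)" by (rule card_Union_le_sum_card)
  also have "\<dots> = (\<Sum>e\<in>?O. 2)" using OE G by (intro sum.cong) (auto simp: simple_graph_def)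
  finally have X: "card ?X \<le> 2 * card ?O" by simp
  define f where "f e = (SOME x. x \<in> e \<and> P x \<noteq> None)" for e
  have f: "f e \<in> e \<and> P (f e) \<noteq> None" if "e \<in> ?M1" for e
    unfolding f_def by (rule someI_ex) (use that in blast)
  have "card ?M1 \<le> card ?X"
  proof (rule card_inj_on_le[of f])
    show "inj_on f ?M1"
    proof (rule inj_onI)
      fix e e' assume *: "e \<in> ?M1" "e' \<in> ?M1" "f e = f e'"
      then have "f e \<in> e \<inter> e'" using f[of e] f[of e'] by auto
      then show "e = e'" using M * unfolding is_matching_def by blast
    qed
    show "f ` ?M1 \<subseteq> ?X"
    proof
      fix x assume "x \<in> f ` ?M1"
      then obtain e where e: "e \<in> ?M1" "x = f e" by blast
      then have "e \<subseteq> V" using ME G by (auto simp: simple_graph_def)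
      then show "x \<in> ?X" using f[OF e(1)] e(2) by blast
    qed
    show "finite ?X" using fin by simp
  qed
  moreover have "card M \<le> card ?M1 + card {e\<in>M. \<forall>x\<in>e. P x = None}"
  proof -
    have "card M \<le> card (?M1 \<union> {e\<in>M. \<forall>x\<in>e. P x = None})" using finM by (intro card_mono) auto
    also note card_Un_le
    finally show ?thesis .
  qed
  ultimately show ?thesis using X by linarith
qed

text \<open>Markov's inequality for the number \<open>Z\<close> of surviving edges of a maximum
  matching, whose mean is at most \<open>p\<close> times the size of that matching.\<close>

lemma approximation_prob:
  fixes N :: "'w pmf" and out :: "'w \<Rightarrow> nat \<Rightarrow> nat option"
  assumes G: "simple_graph V E" and P: "\<And>\<omega>. proper E (out \<omega>)" and eps: "0 < \<epsilon>" "\<epsilon> < 1"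
    and p: "0 \<le> p"
    and surv: "\<And>u v. {u, v} \<in> E \<Longrightarrow> measure_pmf.prob N {\<omega>. out \<omega> u = None \<and> out \<omega> v = None} \<le> p"
  shows "measure_pmf.prob N {\<omega>. real (max_matching_size E) / (2 + \<epsilon>) \<le> real (card (output_matching V (out \<omega>)))}
     \<ge> 1 - 3 * p / \<epsilon>"
proof -
  obtain M where M: "is_matching E M" "card M = max_matching_size E" by (rule max_matching_attained[OF G])
  have ME: "M \<subseteq> E" using M by (auto simp: is_matching_def)
  then have finM: "finite M" using finite_edges[OF G] finite_subset by blast
  let ?m = "real (card M)"
  define Z where "Z \<omega> = real (card {e\<in>M. \<forall>x\<in>e. out \<omega> x = None})" for \<omega>
  have good: "?m / (2 + \<epsilon>) \<le> real (card (output_matching V (out \<omega>)))" if "Z \<omega> \<le> \<epsilon> / 3 * ?m" for \<omega>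
  proof -
    have "card M \<le> 2 * card (output_matching V (out \<omega>)) + card {e\<in>M. \<forall>x\<in>e. out \<omega> x = None}"
      by (rule card_matching_le[OF G P M(1)])
    then have "?m \<le> 2 * real (card (output_matching V (out \<omega>))) + Z \<omega>"
      unfolding Z_def of_nat_le_iff[where 'a = real, symmetric] by simp
    then have 1: "?m * (1 - \<epsilon> / 3) / 2 \<le> real (card (output_matching V (out \<omega>)))"
      using that by (simp add: algebra_simps)
    \<comment> \<open>The threshold \<open>\<epsilon> / 3\<close> works because
      \<open>(1 - \<epsilon> / 3) * (2 + \<epsilon>)\<close> equals
      \<open>2 + \<epsilon> * (1 - \<epsilon>) / 3\<close>.\<close>
    have "\<epsilon> * \<epsilon> \<le> \<epsilon> * 1" using eps by (intro mult_left_mono) auto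
    then have "2 \<le> (1 - \<epsilon> / 3) * (2 + \<epsilon>)" by (simp add: algebra_simps)
    then have "?m * 2 \<le> ?m * ((1 - \<epsilon> / 3) * (2 + \<epsilon>))" by (intro mult_left_mono) auto
    then have "?m / (2 + \<epsilon>) \<le> ?m * (1 - \<epsilon> / 3) / 2" using eps by (simp add: field_simps)
    then show ?thesis using 1 by linarith
  qed
  have "measure_pmf.prob N {\<omega>. Z \<omega> \<le> \<epsilon> / 3 * ?m} \<ge> 1 - 3 * p / \<epsilon>"
  \<comment> \<open>For an empty matching the Markov threshold would be 0.\<close>
  proof (cases "card M = 0")
    case True
    then have "Z \<omega> = 0" for \<omega> using finM by (simp add: Z_def)
    then show ?thesis using True p eps by simp
  next
    case False
    then have m: "?m > 0" by simp
    have Zsum: "Z \<omega> = (\<Sum>e\<in>M. indicator {\<omega>. \<forall>x\<in>e. out \<omega> x = None} \<omega>)" for \<omega>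
      using finM by (simp add: Z_def indicator_def sum.If_cases Int_def)
    have Z0: "0 \<le> Z \<omega>" for \<omega> by (simp add: Z_def)
    have int: "integrable N Z"
      unfolding Zsum[abs_def] by (intro Bochner_Integration.integrable_sum integrable_real_indicator) (auto simp: measure_pmf.emeasure_eq_measure)
    have "measure_pmf.expectation N Z = (\<Sum>e\<in>M. measure_pmf.prob N {\<omega>. \<forall>x\<in>e. out \<omega> x = None})"
      unfolding Zsum[abs_def] by (subst Bochner_Integration.integral_sum) (auto simp: measure_pmf.emeasure_eq_measure intro!: integrable_real_indicator)
    also have "\<dots> \<le> (\<Sum>e\<in>M. p)"
    proof (rule sum_mono)
      fix e assume "e \<in> M"
      then have "e \<in> E" "card e = 2" using ME G by (auto simp: simple_graph_def)
      then obtain u v where "e = {u, v}" by (auto simp: card_2_iff)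
      then show "measure_pmf.prob N {\<omega>. \<forall>x\<in>e. out \<omega> x = None} \<le> p" using surv[of u v] \<open>e \<in> E\<close> by simp
    qed
    finally have EZ: "measure_pmf.expectation N Z \<le> ?m * p" by simp
    have pos: "\<epsilon> / 3 * ?m > 0" using eps m by simp
    have "measure_pmf.prob N {\<omega> \<in> space N. Z \<omega> \<ge> \<epsilon> / 3 * ?m} \<le> measure_pmf.expectation N Z / (\<epsilon> / 3 * ?m)"
      using int pos by (intro integral_Markov_inequality_measure[of _ _ "{}"]) (auto simp: Z0)
    also have "\<dots> \<le> ?m * p / (\<epsilon> / 3 * ?m)" using EZ pos by (intro divide_right_mono) auto
    also have "\<dots> = 3 * p / \<epsilon>" using m by simp
    finally have "measure_pmf.prob N {\<omega>. Z \<omega> \<ge> \<epsilon> / 3 * ?m} \<le> 3 * p / \<epsilon>" by simp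
    moreover have "measure_pmf.prob N {\<omega>. Z \<omega> > \<epsilon> / 3 * ?m} \<le> measure_pmf.prob N {\<omega>. Z \<omega> \<ge> \<epsilon> / 3 * ?m}"
      by (intro measure_pmf.finite_measure_mono) auto
    moreover have "measure_pmf.prob N {\<omega>. Z \<omega> \<le> \<epsilon> / 3 * ?m} = 1 - measure_pmf.prob N {\<omega>. Z \<omega> > \<epsilon> / 3 * ?m}"
    proof -
      have "{\<omega>. Z \<omega> \<le> \<epsilon> / 3 * ?m} = space N - {\<omega>. Z \<omega> > \<epsilon> / 3 * ?m}" by auto
      then show ?thesis by (simp only: measure_pmf.prob_compl sets_measure_pmf UNIV_I)
    qed
    ultimately show ?thesis by linarith
  qed
  also have "measure_pmf.prob N {\<omega>. Z \<omega> \<le> \<epsilon> / 3 * ?m} \<le>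
     measure_pmf.prob N {\<omega>. ?m / (2 + \<epsilon>) \<le> real (card (output_matching V (out \<omega>)))}"
    using good by (intro measure_pmf.finite_measure_mono) auto
  finally show ?thesis using M by simp
qed

section \<open>The LOCAL algorithm\<close>

text \<open>Every node runs the whole algorithm on the subgraph it knows.\<close>
definition matching_rule :: "nat \<Rightarrow> nat \<Rightarrow> nat \<Rightarrow> nat \<Rightarrow> nat \<Rightarrow> (nat \<Rightarrow> draw list) \<Rightarrow> view \<Rightarrow> nat option" where
  "matching_rule K Q R B N \<beta> = (\<lambda>(v, E, \<rho>). fst (run K Q R E B (\<lambda>u. tape N \<beta> (\<rho> u)) initial) v)"

text \<open>The graph and inputs in the view agree with the true ones up to distance
  \<open>r\<close>, which is what \<open>run_local\<close> asks for; the last round supplies its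
  positive start radius \<open>k = 1\<close>.\<close>

lemma matching_rule_output:
  assumes G: "simple_graph V E" and v: "v \<in> V" and r: "r = B * (3 * R + 2) + 1"
  shows "local_output (matching_rule K Q R B N \<beta>) r E \<rho> v
    = fst (run K Q R E B (\<lambda>u. if u \<in> V then tape N \<beta> (\<rho> u) else d) initial) v"
proof -
  let ?E = "known_edges E r v" and ?\<rho> = "\<lambda>u. if u \<in> gball E r v then \<rho> u else 0"
  let ?W = "\<lambda>u. if u \<in> V then tape N \<beta> (\<rho> u) else d"
  have ne: "e \<noteq> {}" if "e \<in> E" for e using G that by (auto simp: simple_graph_def)
  have ag: "agree E ?E ?W (\<lambda>u. tape N \<beta> (?\<rho> u)) r v"
  proof (rule agree_I)
    fix j u e assume *: "j < r" "u \<in> gball E j v" "u \<in> e"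
    then have "u \<in> gball E (r - 1) v" using gball_mono[of j "r - 1" E v] by (auto simp: subset_iff)
    then show "e \<in> E \<longleftrightarrow> e \<in> ?E" using * by (auto simp: known_edges_def)
  next
    fix u assume "u \<in> gball E r v"
    then show "?W u = tape N \<beta> (?\<rho> u)" using gball_subset[OF G v] by auto
  qed
  have "fst (run K Q R E B ?W initial) v = fst (run K Q R ?E B (\<lambda>u. tape N \<beta> (?\<rho> u)) initial) v"
    by (rule run_local[where ?W1.0 = ?W and ?W2.0 = "\<lambda>u. tape N \<beta> (?\<rho> u)" and k = 1])
      (use ne ag r in \<open>auto simp: known_edges_def\<close>)
  then show ?thesis by (simp add: local_output_def local_view_def matching_rule_def)
qed

text \<open>All local outputs are read off one global run that keeps \<open>proper\<close>, so
  consistency holds for every \<open>\<rho>\<close>. For the probability, the real inputs are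
  exchanged for uniform lists of draws.\<close>

lemma matching_rule_correct:
  fixes K Q R B N :: nat
  defines "q \<equiv> replicate_pmf B (pmf_of_set (draws R Q))"
  assumes G: "simple_graph V E" and eps: "0 < \<epsilon>" "\<epsilon> < 1"
    and K: "K > 1" and Q: "Q > 0" and R: "R > 0"
    and Qbig: "2 * real K * real (card V) / real Q \<le> ln (real K) / 2"
    and Bbig: "16 * ln (real (card V)) / ln (real R + 1) \<le> real B * real R * ln (real K)"
    and N: "N = card (set_pmf q)" and \<beta>: "bij_betw \<beta> {..<N} (set_pmf q)"
    and r: "r = B * (3 * R + 2) + 1"
  defines "alg \<equiv> local_output (matching_rule K Q R B N \<beta>) r E"
  shows "consistent_output V E (alg \<rho>)"
    and "measure (rand_space V) {\<rho> \<in> space (rand_space V).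
        real (card (output_matching V (alg \<rho>))) \<ge> real (max_matching_size E) / (2 + \<epsilon>)}
      \<ge> 1 - 3 * exp (- (real B * ln (real K) / (128 * real R ^ 4 * real K))) / \<epsilon>"
proof -
  let ?D = "draws R Q"
  obtain x where "x \<in> ?D" using draws_nonempty[OF R Q] by auto
  define d where "d = replicate B x"
  define out where "out \<omega> = fst (run K Q R E B \<omega> initial)" for \<omega>
  define in\<rho> where "in\<rho> \<rho> = (\<lambda>u. if u \<in> V then tape N \<beta> (\<rho> u) else d)" for \<rho> :: "nat \<Rightarrow> real"
  have V: "finite V" using G by (auto simp: simple_graph_def)
  have alg: "alg \<rho> v = out (in\<rho> \<rho>) v" if "v \<in> V" for v \<rho>
    unfolding alg_def out_def in\<rho>_def by (rule matching_rule_output[OF G that r])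
  have proper: "proper E (out \<omega>)" for \<omega>
    unfolding out_def by (rule proper_run[OF G]) (simp add: proper_def initial_def)
  show "consistent_output V E (alg \<rho>)"
    unfolding consistent_output_def
  proof (intro ballI allI impI)
    fix v w assume v: "v \<in> V" "alg \<rho> v = Some w"
    then have "out (in\<rho> \<rho>) v = Some w" using alg by simp
    then have vw: "{v, w} \<in> E" "out (in\<rho> \<rho>) w = Some v" using proper unfolding proper_def by blast+
    then have "w \<in> V" using G by (auto simp: simple_graph_def)
    then show "{v, w} \<in> E \<and> alg \<rho> w = Some v" using vw alg by simp
  qed
  have om: "output_matching V (alg \<rho>) = output_matching V (out (in\<rho> \<rho>))" for \<rho>
    unfolding output_matching_def using alg by force
  have D: "finite ?D" "?D \<noteq> {}" using draws_finite draws_nonempty[OF R Q] by auto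
  have sq: "set_pmf q = {l. set l \<subseteq> ?D \<and> length l = B}" unfolding q_def by (rule set_replicate_of_set[OF D])
  have fin: "finite (set_pmf q)" unfolding sq by (rule finite_lists_length_eq[OF D(1)])
  have Nval: "N = card ?D ^ B" unfolding N sq by (rule card_lists_length_eq[OF D(1)])
  have N0: "N > 0" unfolding Nval using D by (simp add: card_gt_0_iff)
  have "measure (rand_space V) {\<rho> \<in> space (rand_space V).
        real (card (output_matching V (alg \<rho>))) \<ge> real (max_matching_size E) / (2 + \<epsilon>)}
    = measure_pmf.prob (Pi_pmf V d (\<lambda>_. q))
        {\<omega>. real (card (output_matching V (out \<omega>))) \<ge> real (max_matching_size E) / (2 + \<epsilon>)}"
    unfolding om in\<rho>_def
  proof (rule rand_space_transfer[OF V measurable_tape fin])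
    fix l assume l: "l \<in> set_pmf q"
    then obtain j where j: "j < N" "l = \<beta> j" using \<beta> by (auto simp: bij_betw_def)
    have "pmf q l = 1 / real (card ?D) ^ B"
      unfolding q_def by (rule pmf_replicate_of_set[OF D]) (use l sq in auto)
    then show "measure (uniform_measure lborel {0..1}) {x. tape N \<beta> x = l} = pmf q l"
      using measure_tape[OF N0 _ j(1), of \<beta>] \<beta> j(2) by (simp add: Nval bij_betw_def)
  next
    fix x :: real
    have "nat \<lfloor>x * real N\<rfloor> mod N \<in> {..<N}" using N0 by simp
    then show "tape N \<beta> x \<in> set_pmf q" using \<beta> unfolding tape_def bij_betw_def by blast
  qed
  also have "\<dots> \<ge> 1 - 3 * exp (- (real B * ln (real K) / (128 * real R ^ 4 * real K))) / \<epsilon>"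
  proof (rule approximation_prob[OF G proper eps])
    fix u v assume "{u, v} \<in> E"
    then show "measure_pmf.prob (Pi_pmf V d (\<lambda>_. q)) {\<omega>. out \<omega> u = None \<and> out \<omega> v = None}
        \<le> exp (- (real B * ln (real K) / (128 * real R ^ 4 * real K)))"
      unfolding d_def q_def out_def by (rule edge_survival[OF G _ K Q R Qbig Bbig])
  qed simp
  finally show "measure (rand_space V) {\<rho> \<in> space (rand_space V).
        real (card (output_matching V (alg \<rho>))) \<ge> real (max_matching_size E) / (2 + \<epsilon>)}
      \<ge> 1 - 3 * exp (- (real B * ln (real K) / (128 * real R ^ 4 * real K))) / \<epsilon>" .
qed

section \<open>Parameters\<close>

text \<open>Serves as the largest radius and also as the base \<open>K\<close> of the
  weights.\<close>

definition radius :: "real \<Rightarrow> nat \<Rightarrow> nat" where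
  "radius \<eta> n = nat \<lceil>ln (real n) powr \<eta>\<rceil>"

text \<open>For \<open>R > 1\<close>, the least number satisfying \<open>Bbig\<close> in
  \<open>edge_survival\<close> with \<open>K = R\<close>.\<close>

definition phases :: "real \<Rightarrow> nat \<Rightarrow> nat" where
  "phases \<eta> n = nat \<lceil>16 * ln (real n) / (real (radius \<eta> n) * ln (real (radius \<eta> n)) * ln (real (radius \<eta> n) + 1))\<rceil>"

text \<open>Since \<open>ln R \<ge> \<eta> * ln L\<close>, the \<open>B\<close> phases of
  \<open>3 * R + 2\<close> rounds take \<open>O(L / (ln L)^2)\<close> rounds, while every power of
  \<open>R\<close> costs only a factor \<open>L powr \<eta>\<close> in the failure exponent.\<close>

lemma parameters:
  fixes \<eta> \<delta> :: real and n :: nat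
  defines "L \<equiv> ln (real n)" and "R \<equiv> radius \<eta> n" and "B \<equiv> phases \<eta> n"
  assumes \<eta>: "0 < \<eta>" "\<eta> \<le> 1 / 16" "8 * \<eta> \<le> \<delta>"
    and large: "2 \<le> L powr \<eta>" "16 * L \<le> real n" "6 + 5 * L powr \<eta> \<le> L / (ln L)\<^sup>2"
      "L powr (1 - 8 * \<eta>) + 2 \<le> L powr (1 - 7 * \<eta>) / 1024"
  shows "R > 1"
    and "2 * real R * real n / real (n\<^sup>2) \<le> ln (real R) / 2"
    and "16 * ln (real n) / ln (real R + 1) \<le> real B * real R * ln (real R)"
    and "real (B * (3 * R + 2) + 1) \<le> (80 / \<eta>\<^sup>2 + 1) * L / (ln L)\<^sup>2"
    and "3 * exp (- (real B * ln (real R) / (128 * real R ^ 4 * real R))) \<le> exp (- (L powr (1 - \<delta>)))"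
proof -
  have L1: "L > 1"
  proof (rule ccontr)
    assume "\<not> L > 1"
    moreover have "L \<ge> 0" unfolding L_def by (cases "n = 0") auto
    ultimately have "L powr \<eta> \<le> 1 powr \<eta>" using \<eta> by (intro powr_mono2) auto
    then show False using large(1) by simp
  qed
  have Rlow: "L powr \<eta> \<le> real R" by (simp add: R_def radius_def L_def)
  have Rup: "real R \<le> L powr \<eta> + 1" using powr_ge_zero[of L \<eta>] unfolding R_def radius_def L_def by linarith
  have R2: "real R \<le> 2 * L powr \<eta>" using Rup large(1) by linarith
  show R1: "R > 1" using Rlow large(1) by linarith
  have lnR: "ln (real R) \<ge> 1 / 2"
  proof -
    have "ln 2 \<le> ln (real R)" using R1 by (intro ln_mono) auto
    then show ?thesis using ln2_ge_two_thirds by linarith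
  qed
  have lnR1: "ln (real R + 1) \<le> real R" "ln (real R) \<le> ln (real R + 1)"
    using R1 ln_add_one_self_le_self[of "real R"] by (auto simp: add.commute)
  define T where "T = 16 * L / (real R * ln (real R) * ln (real R + 1))"
  have T0: "T \<ge> 0" using L1 lnR lnR1 by (simp add: T_def)
  have B: "T \<le> real B" "real B \<le> T + 1"
    using T0 unfolding B_def phases_def T_def R_def L_def by linarith+
  have n0: "real n > 0" using L1 large(2) by linarith
  show "2 * real R * real n / real (n\<^sup>2) \<le> ln (real R) / 2"
  proof -
    have "L powr \<eta> \<le> L powr 1" using L1 \<eta> by (intro powr_mono) auto
    then have "2 * real R \<le> 4 * L" using R2 L1 by simp
    then have "2 * real R / real n \<le> 1 / 4" using large(2) n0 by (simp add: field_simps)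
    moreover have "2 * real R * real n / real (n\<^sup>2) = 2 * real R / real n"
      using n0 by (simp add: power2_eq_square)
    ultimately show ?thesis using lnR by linarith
  qed
  have BR: "16 * L / ln (real R + 1) \<le> real B * real R * ln (real R)"
  proof -
    have "16 * L / ln (real R + 1) = T * (real R * ln (real R))"
      using R1 lnR by (simp add: T_def)
    also have "\<dots> \<le> real B * (real R * ln (real R))" using B(1) lnR by (intro mult_right_mono) auto
    finally show ?thesis by (simp add: mult.assoc)
  qed
  then show "16 * ln (real n) / ln (real R + 1) \<le> real B * real R * ln (real R)" by (simp add: L_def)
  show "real (B * (3 * R + 2) + 1) \<le> (80 / \<eta>\<^sup>2 + 1) * L / (ln L)\<^sup>2"
  proof -
    have lnL: "ln L > 0" using L1 by simp
    have "\<eta> * ln L = ln (L powr \<eta>)" using L1 by (simp add: ln_powr)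
    also have "\<dots> \<le> ln (real R)" using Rlow large(1) by (intro ln_mono) auto
    finally have low: "\<eta> * ln L \<le> ln (real R)" .
    have low1: "\<eta> * ln L \<le> ln (real R + 1)" using low lnR1(2) by linarith
    have "real B * (3 * real R + 2) \<le> (T + 1) * (5 * real R)"
      using B(2) R1 T0 by (intro mult_mono) auto
    moreover have "real (B * (3 * R + 2) + 1) = real B * (3 * real R + 2) + 1"
      by (simp add: algebra_simps)
    ultimately have "real (B * (3 * R + 2) + 1) \<le> (T + 1) * (5 * real R) + 1" by linarith
    also have "\<dots> = T * real R * 5 + 5 * real R + 1" by (simp add: algebra_simps)
    also have "T * real R = 16 * L / (ln (real R) * ln (real R + 1))" using R1 by (simp add: T_def)
    also have "\<dots> \<le> 16 * L / ((\<eta> * ln L) * (\<eta> * ln L))"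
      using low low1 lnL \<eta> L1 lnR R1 by (intro divide_left_mono mult_mono mult_pos_pos) auto
    also have "\<dots> = 16 / \<eta>\<^sup>2 * (L / (ln L)\<^sup>2)" by (simp add: power2_eq_square)
    finally have "real (B * (3 * R + 2) + 1) \<le> 80 / \<eta>\<^sup>2 * (L / (ln L)\<^sup>2) + 5 * real R + 1" by simp
    moreover have "5 * real R + 1 \<le> L / (ln L)\<^sup>2" using Rup large(3) by linarith
    moreover have "(80 / \<eta>\<^sup>2 + 1) * L / (ln L)\<^sup>2 = 80 / \<eta>\<^sup>2 * (L / (ln L)\<^sup>2) + L / (ln L)\<^sup>2"
      by (simp add: algebra_simps add_divide_distrib)
    ultimately show ?thesis by linarith
  qed
  show "3 * exp (- (real B * ln (real R) / (128 * real R ^ 4 * real R))) \<le> exp (- (L powr (1 - \<delta>)))"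
  proof -
    have Rpos: "real R > 0" using R1 by simp
    \<comment> \<open>Bounding \<open>ln (R + 1)\<close> by \<open>R\<close> turns the failure
      exponent into \<open>L / (8 * R ^ 7)\<close>; the constant 1024 below is
      \<open>8 * 2 ^ 7\<close>.\<close>
    have "16 * L / (real R * real R) \<le> 16 * L / (real R * ln (real R + 1))"
      using lnR1 lnR L1 Rpos by (intro divide_left_mono mult_left_mono mult_pos_pos) auto
    also have "\<dots> \<le> real B * ln (real R)" using BR Rpos by (simp add: field_simps)
    finally have "16 * L / (real R * real R) / (128 * real R ^ 4 * real R) \<le> real B * ln (real R) / (128 * real R ^ 4 * real R)"
      by (intro divide_right_mono) auto
    moreover have "16 * L / (real R * real R) / (128 * real R ^ 4 * real R) = L / (8 * real R ^ 7)"
      by (simp add: eval_nat_numeral)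
    moreover have "L / (8 * (2 * L powr \<eta>) ^ 7) \<le> L / (8 * real R ^ 7)"
      using R2 Rpos L1 by (intro divide_left_mono mult_left_mono power_mono mult_pos_pos zero_less_power) auto
    moreover have "L / (8 * (2 * L powr \<eta>) ^ 7) = L powr (1 - 7 * \<eta>) / 1024"
      using L1 by (simp add: power_mult_distrib powr_power powr_diff mult.commute)
    ultimately have "L powr (1 - 8 * \<eta>) + 2 \<le> real B * ln (real R) / (128 * real R ^ 4 * real R)"
      using large(4) by linarith
    moreover have "L powr (1 - \<delta>) \<le> L powr (1 - 8 * \<eta>)" using L1 \<eta> by (intro powr_mono) auto
    \<comment> \<open>The summand 2 in the last largeness assumption absorbs the factor 3 from
      Markov's inequality.\<close>
    moreover have "(3::real) \<le> exp 2" using exp_ge_add_one_self[of "2::real"] by simp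
    ultimately have "3 * exp (- (real B * ln (real R) / (128 * real R ^ 4 * real R)))
        \<le> exp 2 * exp (- (L powr (1 - \<delta>) + 2))"
      by (intro mult_mono) auto
    then show ?thesis by (simp flip: exp_add)
  qed
qed

lemma eventually_large:
  fixes \<eta> :: real
  assumes "0 < \<eta>" "\<eta> \<le> 1 / 16"
  shows "\<forall>\<^sub>F n in sequentially. 2 \<le> ln (real n) powr \<eta> \<and> 16 * ln (real n) \<le> real n
    \<and> 6 + 5 * ln (real n) powr \<eta> \<le> ln (real n) / (ln (ln (real n)))\<^sup>2
    \<and> ln (real n) powr (1 - 8 * \<eta>) + 2 \<le> ln (real n) powr (1 - 7 * \<eta>) / 1024"
proof -
  have lim: "filterlim (\<lambda>n::nat. ln (real n)) at_top sequentially" by real_asymp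
  have "\<forall>\<^sub>F L::real in at_top. 2 \<le> L powr \<eta>" using assms by real_asymp
  moreover have "\<forall>\<^sub>F L::real in at_top. 6 + 5 * L powr \<eta> \<le> L / (ln L)\<^sup>2" using assms by real_asymp
  moreover have "\<forall>\<^sub>F L::real in at_top. L powr (1 - 8 * \<eta>) + 2 \<le> L powr (1 - 7 * \<eta>) / 1024"
    using assms by real_asymp
  ultimately have "\<forall>\<^sub>F L::real in at_top. 2 \<le> L powr \<eta> \<and> 6 + 5 * L powr \<eta> \<le> L / (ln L)\<^sup>2
      \<and> L powr (1 - 8 * \<eta>) + 2 \<le> L powr (1 - 7 * \<eta>) / 1024"
    by eventually_elim blast
  then have "\<forall>\<^sub>F n in sequentially. 2 \<le> ln (real n) powr \<eta>
    \<and> 6 + 5 * ln (real n) powr \<eta> \<le> ln (real n) / (ln (ln (real n)))\<^sup>2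
    \<and> ln (real n) powr (1 - 8 * \<eta>) + 2 \<le> ln (real n) powr (1 - 7 * \<eta>) / 1024"
    using lim by (rule eventually_compose_filterlim)
  moreover have "\<forall>\<^sub>F n::nat in sequentially. 16 * ln (real n) \<le> real n" by real_asymp
  ultimately show ?thesis by eventually_elim blast
qed

theorem theorem1:
  fixes \<delta> :: real
  assumes "\<delta> > 0"
  shows "\<exists>C c N0. c > 0 \<and>
    (\<forall>eps :: nat \<Rightarrow> real. (\<forall>n. 0 < eps n \<and> eps n < 1) \<longrightarrow>
      (\<exists>(r :: nat \<Rightarrow> nat) (A :: nat \<Rightarrow> view \<Rightarrow> nat option). \<forall>n \<ge> N0.
         real (r n) \<le> C * ln (real n) / (ln (ln (real n)))^2 \<and>
         (\<forall>V E. simple_graph V E \<and> card V = n \<longrightarrow>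
            (AE \<rho> in rand_space V. consistent_output V E (local_output (A n) (r n) E \<rho>)) \<and>
            measure (rand_space V)
              {\<rho> \<in> space (rand_space V).
                 real (card (output_matching V (local_output (A n) (r n) E \<rho>)))
                   \<ge> real (max_matching_size E) / (2 + eps n)}
            \<ge> 1 - (1 / eps n) * exp (- (c * ln (real n) powr (1 - \<delta>))))))"
proof -
  \<comment> \<open>Capping \<open>\<delta>\<close> at \<open>1 / 2\<close> keeps exponents such as
    \<open>1 - 8 * \<eta>\<close> positive.\<close>
  define \<eta> where "\<eta> = min \<delta> (1 / 2) / 8"
  have \<eta>: "0 < \<eta>" "\<eta> \<le> 1 / 16" "8 * \<eta> \<le> \<delta>" using assms by (auto simp: \<eta>_def)
  obtain N0 where N0: "\<And>n. n \<ge> N0 \<Longrightarrow> 2 \<le> ln (real n) powr \<eta> \<and> 16 * ln (real n) \<le> real n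
    \<and> 6 + 5 * ln (real n) powr \<eta> \<le> ln (real n) / (ln (ln (real n)))\<^sup>2
    \<and> ln (real n) powr (1 - 8 * \<eta>) + 2 \<le> ln (real n) powr (1 - 7 * \<eta>) / 1024"
    using eventually_large[OF \<eta>(1,2)] unfolding eventually_sequentially by blast
  \<comment> \<open>One algorithm serves all \<open>\<epsilon>\<close>, which enters only through
    Markov's inequality.\<close>
  define R B where "R = radius \<eta>" and "B = phases \<eta>"
  \<comment> \<open>With \<open>Q = n ^ 2\<close> tokens the rounding loss per step is
    \<open>2 * R / n\<close>.\<close>
  define q where "q n = replicate_pmf (B n) (pmf_of_set (draws (R n) (n\<^sup>2)))" for n
  define N where "N n = card (set_pmf (q n))" for n
  \<comment> \<open>An arbitrary enumeration of the lists of draws, fixed for each \<open>n\<close>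
    and hence common to all vertices.\<close>
  define \<beta> where "\<beta> n = (SOME h. bij_betw h {..<N n} (set_pmf (q n)))" for n
  define A where "A n = matching_rule (R n) (n\<^sup>2) (R n) (B n) (N n) (\<beta> n)" for n
  define r where "r n = B n * (3 * R n + 2) + 1" for n
  have main: "real (r n) \<le> (80 / \<eta>\<^sup>2 + 1) * ln (real n) / (ln (ln (real n)))^2 \<and>
         (\<forall>V E. simple_graph V E \<and> card V = n \<longrightarrow>
            (AE \<rho> in rand_space V. consistent_output V E (local_output (A n) (r n) E \<rho>)) \<and>
            measure (rand_space V)
              {\<rho> \<in> space (rand_space V).
                 real (card (output_matching V (local_output (A n) (r n) E \<rho>)))
                   \<ge> real (max_matching_size E) / (2 + e)}
            \<ge> 1 - (1 / e) * exp (- (1 * ln (real n) powr (1 - \<delta>))))"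
    if n: "n \<ge> N0" and e: "0 < e" "e < 1" for n e
  proof (intro conjI allI impI)
    note par = parameters[OF \<eta>, of n, folded R_def B_def]
    have large: "2 \<le> ln (real n) powr \<eta>" "16 * ln (real n) \<le> real n"
      "6 + 5 * ln (real n) powr \<eta> \<le> ln (real n) / (ln (ln (real n)))\<^sup>2"
      "ln (real n) powr (1 - 8 * \<eta>) + 2 \<le> ln (real n) powr (1 - 7 * \<eta>) / 1024"
      using N0[OF n] by blast+
    show "real (r n) \<le> (80 / \<eta>\<^sup>2 + 1) * ln (real n) / (ln (ln (real n)))^2"
      unfolding r_def by (rule par(4)[OF large])
    fix V E assume "simple_graph V E \<and> card V = n"
    then have G: "simple_graph V E" and cV: "card V = n" by auto
    have R1: "R n > 1" by (rule par(1)[OF large])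
    have "n \<noteq> 0" using large(1) by (intro notI) simp
    then have Q: "n\<^sup>2 > 0" by simp
    have D: "finite (draws (R n) (n\<^sup>2))" "draws (R n) (n\<^sup>2) \<noteq> {}"
      using draws_finite draws_nonempty[of "R n" "n\<^sup>2"] R1 Q by auto
    have "finite (set_pmf (q n))"
      unfolding q_def set_replicate_of_set[OF D] by (rule finite_lists_length_eq[OF D(1)])
    then have "\<exists>h. bij_betw h {..<N n} (set_pmf (q n))"
      unfolding N_def using ex_bij_betw_nat_finite by (metis atLeast0LessThan)
    then have \<beta>: "bij_betw (\<beta> n) {..<N n} (set_pmf (q n))" unfolding \<beta>_def by (rule someI_ex)
    have R0: "R n > 0" using R1 by simp
    note correct = matching_rule_correct[OF G e R1 Q R0 _ _ N_def[unfolded q_def] \<beta>[unfolded q_def] r_def,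
        unfolded cV, OF par(2)[OF large] par(3)[OF large], folded A_def]
    show "AE \<rho> in rand_space V. consistent_output V E (local_output (A n) (r n) E \<rho>)"
      using correct(1) by simp
    have "3 * exp (- (real (B n) * ln (real (R n)) / (128 * real (R n) ^ 4 * real (R n)))) / e
       \<le> exp (- (ln (real n) powr (1 - \<delta>))) / e"
      using par(5)[OF large] e by (intro divide_right_mono) auto
    then show "measure (rand_space V)
              {\<rho> \<in> space (rand_space V).
                 real (card (output_matching V (local_output (A n) (r n) E \<rho>)))
                   \<ge> real (max_matching_size E) / (2 + e)}
            \<ge> 1 - (1 / e) * exp (- (1 * ln (real n) powr (1 - \<delta>)))"
      using correct(2) by simp
  qed
  show ?thesis
    by (rule exI[of _ "80 / \<eta>\<^sup>2 + 1"], rule exI[of _ "1::real"], rule exI[of _ N0])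
      (use main in \<open>auto intro!: exI[of _ r] exI[of _ A]\<close>)
qed

end
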